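(* Let $t_1, t_2 > 0$ be threshold values and let $\varphi = \bigwedge_{i=1}^n \varphi_i$ be an $\mathsf{LTLf}$ formula over a finite set of propositions $\mathsf{Prop}$, given as a conjunction of $\mathsf{LTLf}$ subformulas $\varphi_1,\dots,\varphi_n$. Then the algorithm $\mathsf{Lisa}(\varphi, t_1, t_2)$ described below terminates and returns a DFA for $\varphi$ with symbolic states, i.e. a symbolic-state DFA $(\mathcal{S},\mathcal{T},\mathcal{F})$ over alphabet $2^{\mathsf{Prop}}$ whose language equals $\mathcal{L}(\varphi)$, the set of finite words over $2^{\mathsf{Prop}}$ satisfying $\varphi$.
   Context: $\mathsf{LTLf}$ is linear temporal logic interpreted over finite traces: formulas are built by $\varphi ::= a \in \mathsf{Prop} \mid \neg\varphi \mid \varphi\wedge\varphi \mid \varphi\vee\varphi \mid \mathsf{X}\varphi \mid \varphi\,\mathsf{U}\,\varphi \mid \mathsf{F}\varphi \mid \mathsf{G}\varphi$, with the standard finite-trace semantics; $\mathcal{L}(\varphi)$ is the set of finite words over $2^{\mathsf{Prop}}$ satisfying $\varphi$. A DFA is $D=(\Sigma,S,\iota,\Delta,F)$ with $\Delta:S\times\Sigma\to S$; a word $w_0\dots w_m$ is accepted if its run $s_0=\iota$, $s_{j+1}=\Delta(s_j,w_j)$ ends in $F$. For an explicit-state DFA $D$, $|D|$ denotes its number of states; $D_1\cap D_2$ denotes the standard product DFA recognizing $\mathcal{L}(D_1)\cap\mathcal{L}(D_2)$. A symbolic-state representation of a DFA $D=(2^{\mathsf{Prop}},S,\iota,\Delta,F)$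 is a triple $(\mathcal{S}(\mathcal{Z}),\mathcal{T}(\mathcal{Z},\mathsf{Prop},\mathcal{Z}'),\mathcal{F}(\mathcal{Z}))$ of Boolean formulas (BDDs), where $\mathcal{Z}=\{z_1,\dots,z_k\}$ with $k=\lceil\log|S|\rceil$ encodes states via an injective assignment of interpretations $Z\in 2^{\mathcal{Z}}$ to states, $\mathcal{Z}'$ is a primed copy encoding next states; $\mathcal{S}$ is satisfied exactly by the encoding of $\iota$, $\mathcal{T}$ is satisfied by $(Z,P,Z')$ iff $\Delta(s,P)=s'$ for the states $s,s'$ encoded by $Z,Z'$, and $\mathcal{F}$ is satisfied by $Z$ iff the encoded state is in $F$. The language of a symbolic DFA is the language of the DFA it encodes. The symbolic intersection of $(\mathcal{S}_1,\mathcal{T}_1,\mathcal{F}_1)$ and $(\mathcal{S}_2,\mathcal{T}_2,\mathcal{F}_2)$ (whose state variable sets are disjoint) is $(\mathcal{S}_1\wedge\mathcal{S}_2,\mathcal{T}_1\wedge\mathcal{T}_2,\mathcal{F}_1\wedge\mathcal{F}_2)$, with state variables the union. Algorithm $\mathsf{Lisa}(\varphi,t_1,t_2)$: (1) Decomposition: for each $i$, construct an explicit-state minimal DFA $D_i$ with $\mathcal{L}(D_i)=\mathcal{L}(\varphi_i)$, and put all $D_i$ into a collection ordered by number of states. (2) Explicit composition: remove the two DFAs $D_1,D_2$ with fewest states (with $|D_1|\le|D_2|$). While $|D_1|<t_1$ and $|D_1|\cdot|D_2|<t_2$: form the minimal DFA equivalent to $D_1\cap D_2$ and insert it into the collection;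 if the collection now has exactly one DFA, convert it to symbolic-state representation and return it; otherwise remove the two DFAs with fewest states and repeat the test. (3) Change of representation: when the loop condition fails, convert every DFA remaining (including the two removed ones) to symbolic-state representation, each using its own fresh set of state variables disjoint from all others, and put them into a collection ordered by the number of BDD nodes of the transition relation. (4) Symbolic composition: while the collection has more than one element, remove the two with fewest transition-BDD nodes, form their symbolic intersection (without minimization), and insert it back. Return the single remaining symbolic DFA. *)

theory Defs
  imports Complex_Main "HOL-Library.Multiset"
begin

section \<open>LTLf\<close>

datatype (ltlf_props: 'p) ltlf =
    Atom 'p
  | Not "'p ltlf"
  | And "'p ltlf" "'p ltlf"
  | Or "'p ltlf" "'p ltlf"
  | Next "'p ltlf"
  | Until "'p ltlf" "'p ltlf"
  | Eventually "'p ltlf"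
  | Always "'p ltlf"

primrec ltlf_sat :: "'p set list \<Rightarrow> nat \<Rightarrow> 'p ltlf \<Rightarrow> bool" where
  "ltlf_sat w i (Atom a) \<longleftrightarrow> i < length w \<and> a \<in> w ! i"
| "ltlf_sat w i (Not \<phi>) \<longleftrightarrow> \<not> ltlf_sat w i \<phi>"
| "ltlf_sat w i (And \<phi> \<psi>) \<longleftrightarrow> ltlf_sat w i \<phi> \<and> ltlf_sat w i \<psi>"
| "ltlf_sat w i (Or \<phi> \<psi>) \<longleftrightarrow> ltlf_sat w i \<phi> \<or> ltlf_sat w i \<psi>"
| "ltlf_sat w i (Next \<phi>) \<longleftrightarrow> Suc i < length w \<and> ltlf_sat w (Suc i) \<phi>"
| "ltlf_sat w i (Until \<phi> \<psi>) \<longleftrightarrow>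
     (\<exists>j. i \<le> j \<and> j < length w \<and> ltlf_sat w j \<psi> \<and> (\<forall>k. i \<le> k \<and> k < j \<longrightarrow> ltlf_sat w k \<phi>))"
| "ltlf_sat w i (Eventually \<phi>) \<longleftrightarrow> (\<exists>j. i \<le> j \<and> j < length w \<and> ltlf_sat w j \<phi>)"
| "ltlf_sat w i (Always \<phi>) \<longleftrightarrow> (\<forall>j. i \<le> j \<and> j < length w \<longrightarrow> ltlf_sat w j \<phi>)"

text \<open>LTLf is interpreted over nonempty finite traces.\<close>

definition ltlf_lang :: "'p set \<Rightarrow> 'p ltlf \<Rightarrow> 'p set list set" where
  "ltlf_lang Props \<phi> = {w \<in> lists (Pow Props). w \<noteq> [] \<and> ltlf_sat w 0 \<phi>}"

text \<open>The grammar has no constant for truth, so the empty conjunction is left unspecified.\<close>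

fun ltlf_Conj :: "'p ltlf list \<Rightarrow> 'p ltlf" where
  "ltlf_Conj [\<phi>] = \<phi>"
| "ltlf_Conj (\<phi> # \<psi> # \<phi>s) = And \<phi> (ltlf_Conj (\<psi> # \<phi>s))"


section \<open>Explicit-state DFAs\<close>

record ('a, 's) dfa =
  alphabet :: "'a set"
  states :: "'s set"
  initial :: 's
  delta :: "'s \<Rightarrow> 'a \<Rightarrow> 's"
  accepting :: "'s set"

definition wf_dfa :: "('a, 's) dfa \<Rightarrow> bool" where
  "wf_dfa D \<longleftrightarrow> finite (alphabet D) \<and> finite (states D) \<and> initial D \<in> states D \<and>
     (\<forall>s \<in> states D. \<forall>a \<in> alphabet D. delta D s a \<in> states D) \<and> accepting D \<subseteq> states D"

definition dfa_lang :: "('a, 's) dfa \<Rightarrow> 'a list set" where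
  "dfa_lang D = {w \<in> lists (alphabet D). foldl (delta D) (initial D) w \<in> accepting D}"

definition dfa_size :: "('a, 's) dfa \<Rightarrow> nat" where
  "dfa_size D = card (states D)"

definition dfa_inter :: "('a, 's) dfa \<Rightarrow> ('a, 't) dfa \<Rightarrow> ('a, 's \<times> 't) dfa" where
  "dfa_inter D1 D2 =
     \<lparr>alphabet = alphabet D1 \<inter> alphabet D2,
      states = states D1 \<times> states D2,
      initial = (initial D1, initial D2),
      delta = (\<lambda>(s, t) a. (delta D1 s a, delta D2 t a)),
      accepting = accepting D1 \<times> accepting D2\<rparr>"

text \<open>Every finite DFA is isomorphic to one whose states are natural numbers, so comparing
  with DFAs of that type alone loses nothing.\<close>

definition minimal_dfa :: "'a set \<Rightarrow> 'a list set \<Rightarrow> ('a, nat) dfa \<Rightarrow> bool" where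
  "minimal_dfa \<Sigma> L D \<longleftrightarrow> wf_dfa D \<and> alphabet D = \<Sigma> \<and> dfa_lang D = L \<and>
     (\<forall>D' :: ('a, nat) dfa. wf_dfa D' \<and> alphabet D' = \<Sigma> \<and> dfa_lang D' = L \<longrightarrow>
        dfa_size D \<le> dfa_size D')"


section \<open>BDDs\<close>

text \<open>Decision diagrams are represented by their unfoldings into trees;
  \<open>Ite v b c\<close> tests \<open>v\<close> and continues with \<open>b\<close> if it is true and with \<open>c\<close> otherwise.
  Interpretations are sets of true variables.\<close>

datatype (bdd_vars: 'v) bdd =
    Const bool
  | Ite 'v "'v bdd" "'v bdd"

primrec bdd_sat :: "'v set \<Rightarrow> 'v bdd \<Rightarrow> bool" where
  "bdd_sat I (Const x) \<longleftrightarrow> x"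
| "bdd_sat I (Ite v b c) \<longleftrightarrow> (if v \<in> I then bdd_sat I b else bdd_sat I c)"

text \<open>Reduced and ordered with respect to a linear order \<open>r\<close> on the variables.\<close>

primrec robdd :: "'v rel \<Rightarrow> 'v bdd \<Rightarrow> bool" where
  "robdd r (Const x) \<longleftrightarrow> True"
| "robdd r (Ite v b c) \<longleftrightarrow> b \<noteq> c \<and> (\<forall>u \<in> bdd_vars b \<union> bdd_vars c. u \<noteq> v \<and> (v, u) \<in> r) \<and>
     robdd r b \<and> robdd r c"

primrec sub_bdds :: "'v bdd \<Rightarrow> 'v bdd set" where
  "sub_bdds (Const x) = {Const x}"
| "sub_bdds (Ite v b c) = insert (Ite v b c) (sub_bdds b \<union> sub_bdds c)"

text \<open>In the diagram, equal subtrees are shared.\<close>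

definition bdd_nodes :: "'v bdd \<Rightarrow> nat" where
  "bdd_nodes b = card (sub_bdds b)"

definition bdd_mk :: "'v \<Rightarrow> 'v bdd \<Rightarrow> 'v bdd \<Rightarrow> 'v bdd" where
  "bdd_mk v b c = (if b = c then b else Ite v b c)"

fun bdd_conj :: "'v rel \<Rightarrow> 'v bdd \<Rightarrow> 'v bdd \<Rightarrow> 'v bdd" where
  "bdd_conj r (Const x) b = (if x then b else Const False)"
| "bdd_conj r b (Const x) = (if x then b else Const False)"
| "bdd_conj r (Ite u b1 c1) (Ite v b2 c2) =
     (if u = v then bdd_mk u (bdd_conj r b1 b2) (bdd_conj r c1 c2)
      else if (u, v) \<in> r
        then bdd_mk u (bdd_conj r b1 (Ite v b2 c2)) (bdd_conj r c1 (Ite v b2 c2))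
        else bdd_mk v (bdd_conj r (Ite u b1 c1) b2) (bdd_conj r (Ite u b1 c1) c2))"


section \<open>Symbolic-state DFAs\<close>

text \<open>State variables are named by natural numbers; \<open>Cur z\<close> is the variable \<open>z\<close> itself and
  \<open>Primed z\<close> its copy for the next state.\<close>

datatype 'p bvar = Pr 'p | Cur nat | Primed nat

record 'p sym_dfa =
  state_vars :: "nat set"
  sym_init :: "'p bvar bdd"
  sym_trans :: "'p bvar bdd"
  sym_final :: "'p bvar bdd"

definition encodes :: "'p bvar rel \<Rightarrow> 'p set \<Rightarrow> 'p sym_dfa \<Rightarrow> ('p set, 's) dfa \<Rightarrow> bool" where
  "encodes r Props A D \<longleftrightarrow>
     wf_dfa D \<and> alphabet D = Pow Props \<and> finite (state_vars A) \<and>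
     robdd r (sym_init A) \<and> bdd_vars (sym_init A) \<subseteq> Cur ` state_vars A \<and>
     robdd r (sym_trans A) \<and>
       bdd_vars (sym_trans A) \<subseteq> Cur ` state_vars A \<union> Pr ` Props \<union> Primed ` state_vars A \<and>
     robdd r (sym_final A) \<and> bdd_vars (sym_final A) \<subseteq> Cur ` state_vars A \<and>
     (\<exists>enc. inj_on enc (states D) \<and> enc ` states D \<subseteq> Pow (state_vars A) \<and>
        (\<forall>Z \<subseteq> state_vars A. bdd_sat (Cur ` Z) (sym_init A) \<longleftrightarrow> Z = enc (initial D)) \<and>
        (\<forall>Z \<subseteq> state_vars A. \<forall>P \<subseteq> Props. \<forall>Z' \<subseteq> state_vars A.
           bdd_sat (Cur ` Z \<union> Pr ` P \<union> Primed ` Z') (sym_trans A) \<longleftrightarrow>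
           (\<exists>s \<in> states D. \<exists>s' \<in> states D. enc s = Z \<and> enc s' = Z' \<and> delta D s P = s')) \<and>
        (\<forall>Z \<subseteq> state_vars A. bdd_sat (Cur ` Z) (sym_final A) \<longleftrightarrow>
           (\<exists>s \<in> states D. enc s = Z \<and> s \<in> accepting D)))"

text \<open>Only the conversion of an explicit DFA fixes the number of state variables: a symbolic
  intersection may use more than \<open>\<lceil>log 2 (dfa_size D)\<rceil>\<close> of them.\<close>

definition symbolic_rep :: "'p bvar rel \<Rightarrow> 'p set \<Rightarrow> ('p set, 's) dfa \<Rightarrow> 'p sym_dfa \<Rightarrow> bool" where
  "symbolic_rep r Props D A \<longleftrightarrow>
     encodes r Props A D \<and> int (card (state_vars A)) = \<lceil>log 2 (real (dfa_size D))\<rceil>"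

definition symbolic_dfa :: "'p bvar rel \<Rightarrow> 'p set \<Rightarrow> 'p sym_dfa \<Rightarrow> bool" where
  "symbolic_dfa r Props A \<longleftrightarrow> (\<exists>D :: ('p set, nat) dfa. encodes r Props A D)"

text \<open>The encoded DFA is unique up to isomorphism; see \<open>symbolic_lang_eq\<close> below.\<close>

definition symbolic_lang :: "'p bvar rel \<Rightarrow> 'p set \<Rightarrow> 'p sym_dfa \<Rightarrow> 'p set list set" where
  "symbolic_lang r Props A =
     {w. \<exists>D :: ('p set, nat) dfa. encodes r Props A D \<and> w \<in> dfa_lang D}"

definition sym_inter :: "'p bvar rel \<Rightarrow> 'p sym_dfa \<Rightarrow> 'p sym_dfa \<Rightarrow> 'p sym_dfa" where
  "sym_inter r A1 A2 =
     \<lparr>state_vars = state_vars A1 \<union> state_vars A2,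
      sym_init = bdd_conj r (sym_init A1) (sym_init A2),
      sym_trans = bdd_conj r (sym_trans A1) (sym_trans A2),
      sym_final = bdd_conj r (sym_final A1) (sym_final A2)\<rparr>"

lemma encodes_lang_subset:
  fixes D :: "('p set, 's) dfa" and D' :: "('p set, 't) dfa"
  assumes "encodes r Props A D" "encodes r Props A D'"
  shows "dfa_lang D \<subseteq> dfa_lang D'"
proof -
  from assms(1)[unfolded encodes_def] obtain e where D: "wf_dfa D" "alphabet D = Pow Props"
    and e: "inj_on e (states D)" "e ` states D \<subseteq> Pow (state_vars A)"
      "\<forall>Z \<subseteq> state_vars A. bdd_sat (Cur ` Z) (sym_init A) \<longleftrightarrow> Z = e (initial D)"
      "\<forall>Z \<subseteq> state_vars A. \<forall>P \<subseteq> Props. \<forall>Z' \<subseteq> state_vars A.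
         bdd_sat (Cur ` Z \<union> Pr ` P \<union> Primed ` Z') (sym_trans A) \<longleftrightarrow>
         (\<exists>s \<in> states D. \<exists>s' \<in> states D. e s = Z \<and> e s' = Z' \<and> delta D s P = s')"
      "\<forall>Z \<subseteq> state_vars A. bdd_sat (Cur ` Z) (sym_final A) \<longleftrightarrow>
         (\<exists>s \<in> states D. e s = Z \<and> s \<in> accepting D)"
    by (elim conjE exE) (rule that)
  from assms(2)[unfolded encodes_def] obtain e' where D': "wf_dfa D'" "alphabet D' = Pow Props"
    and e': "inj_on e' (states D')" "e' ` states D' \<subseteq> Pow (state_vars A)"
      "\<forall>Z \<subseteq> state_vars A. bdd_sat (Cur ` Z) (sym_init A) \<longleftrightarrow> Z = e' (initial D')"
      "\<forall>Z \<subseteq> state_vars A. \<forall>P \<subseteq> Props. \<forall>Z' \<subseteq> state_vars A.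
         bdd_sat (Cur ` Z \<union> Pr ` P \<union> Primed ` Z') (sym_trans A) \<longleftrightarrow>
         (\<exists>s \<in> states D'. \<exists>s' \<in> states D'. e' s = Z \<and> e' s' = Z' \<and> delta D' s P = s')"
      "\<forall>Z \<subseteq> state_vars A. bdd_sat (Cur ` Z) (sym_final A) \<longleftrightarrow>
         (\<exists>s \<in> states D'. e' s = Z \<and> s \<in> accepting D')"
    by (elim conjE exE) (rule that)
  have run: "foldl (delta D) s w \<in> states D \<and> foldl (delta D') s' w \<in> states D' \<and>
      e (foldl (delta D) s w) = e' (foldl (delta D') s' w)"
    if "w \<in> lists (Pow Props)" "s \<in> states D" "s' \<in> states D'" "e s = e' s'" for w s s'
    using that
  proof (induction w arbitrary: s s' rule: list.induct)
    case Nil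
    then show ?case by simp
  next
    case (Cons P w)
    have P: "P \<subseteq> Props" and w: "w \<in> lists (Pow Props)" using Cons.prems(1) by auto
    have t: "delta D s P \<in> states D" "delta D' s' P \<in> states D'"
      using D D' P Cons.prems by (auto simp: wf_dfa_def)
    have sub: "e s \<subseteq> state_vars A" "e (delta D s P) \<subseteq> state_vars A"
      using e(2) Cons.prems(2) t(1) by blast+
    have "bdd_sat (Cur ` e s \<union> Pr ` P \<union> Primed ` e (delta D s P)) (sym_trans A)"
      using e(4)[rule_format, OF sub(1) P sub(2)] Cons.prems(2) t(1) by blast
    then obtain u where u: "u \<in> states D'" "e' u = e s" "e' (delta D' u P) = e (delta D s P)"
      using e'(4)[rule_format, OF sub(1) P sub(2)] by blast
    have "u = s'" using u Cons.prems e'(1) by (auto dest: inj_onD)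
    then show ?case using Cons.IH[OF w t] u by simp
  qed
  have i: "initial D \<in> states D" "initial D' \<in> states D'"
    using D D' by (auto simp: wf_dfa_def)
  have ee: "e (initial D) = e' (initial D')"
  proof -
    have "e (initial D) \<subseteq> state_vars A" using e(2) i(1) by blast
    from e(3)[rule_format, OF this] e'(3)[rule_format, OF this] show ?thesis by simp
  qed
  show ?thesis
  proof
    fix w assume w: "w \<in> dfa_lang D"
    then have wl: "w \<in> lists (Pow Props)" using D by (simp add: dfa_lang_def)
    let ?s = "foldl (delta D) (initial D) w" and ?s' = "foldl (delta D') (initial D') w"
    have r: "?s \<in> states D" "?s' \<in> states D'" "e ?s = e' ?s'" using run[OF wl i ee] by auto
    have sub: "e ?s \<subseteq> state_vars A" using e(2) r(1) by blast
    have "?s \<in> accepting D" using w by (simp add: dfa_lang_def)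
    then have "bdd_sat (Cur ` e ?s) (sym_final A)" using e(5)[rule_format, OF sub] r(1) by blast
    then obtain u where "u \<in> states D'" "e' u = e ?s" "u \<in> accepting D'"
      using e'(5)[rule_format, OF sub] by blast
    then have "?s' \<in> accepting D'" using r e'(1) by (metis inj_onD)
    then show "w \<in> dfa_lang D'" using wl D' by (simp add: dfa_lang_def)
  qed
qed

lemma symbolic_lang_eq:
  fixes D :: "('p set, nat) dfa"
  assumes "encodes r Props A D"
  shows "symbolic_lang r Props A = dfa_lang D"
  using assms encodes_lang_subset unfolding symbolic_lang_def by blast


section \<open>The algorithm\<close>

text \<open>\<open>two_least f M x y N\<close>: removing \<open>x\<close> and \<open>y\<close>, two elements of least \<open>f\<close>-value, from the
  collection \<open>M\<close> leaves \<open>N\<close>. Ties may be broken arbitrarily.\<close>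

definition two_least :: "('b \<Rightarrow> nat) \<Rightarrow> 'b multiset \<Rightarrow> 'b \<Rightarrow> 'b \<Rightarrow> 'b multiset \<Rightarrow> bool" where
  "two_least f M x y N \<longleftrightarrow> M = add_mset x (add_mset y N) \<and> f x \<le> f y \<and> (\<forall>z \<in># N. f y \<le> f z)"

type_synonym 'p xdfa = "('p set, nat) dfa"

datatype 'p lisa_config =
    Decompose "'p ltlf list" "'p xdfa multiset"  \<comment> \<open>conjuncts still to be translated; DFAs so far\<close>
  | Explicit "'p xdfa multiset"
  | Test "'p xdfa" "'p xdfa" "'p xdfa multiset"  \<comment> \<open>the two DFAs just removed; the others\<close>
  | Convert "'p xdfa multiset" "'p sym_dfa multiset"
  | Symbolic "'p sym_dfa multiset"
  | Return "'p sym_dfa"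

text \<open>One step of Lisa, for a fixed BDD variable order \<open>r\<close>. The choices left open by the algorithm
  (names of states in minimal DFAs, ties, state variables and encodings, order of processing)
  are nondeterministic. Rule \<open>single\<close> covers both the exit from the explicit loop and an input
  with just one conjunct.\<close>

inductive lisa_step ::
  "'p bvar rel \<Rightarrow> 'p set \<Rightarrow> real \<Rightarrow> real \<Rightarrow> 'p lisa_config \<Rightarrow> 'p lisa_config \<Rightarrow> bool"
  for r Props t1 t2 where
  translate: "minimal_dfa (Pow Props) (ltlf_lang Props \<phi>) D \<Longrightarrow>
    lisa_step r Props t1 t2 (Decompose (\<phi> # \<phi>s) M) (Decompose \<phi>s (add_mset D M))"
| decomposed: "lisa_step r Props t1 t2 (Decompose [] M) (Explicit M)"
| single: "symbolic_rep r Props D A \<Longrightarrow>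
    lisa_step r Props t1 t2 (Explicit {#D#}) (Return A)"
| remove: "two_least dfa_size M D1 D2 N \<Longrightarrow>
    lisa_step r Props t1 t2 (Explicit M) (Test D1 D2 N)"
| compose: "real (dfa_size D1) < t1 \<and> real (dfa_size D1 * dfa_size D2) < t2 \<Longrightarrow>
    minimal_dfa (Pow Props) (dfa_lang (dfa_inter D1 D2)) D \<Longrightarrow>
    lisa_step r Props t1 t2 (Test D1 D2 N) (Explicit (add_mset D N))"
| switch: "\<not> (real (dfa_size D1) < t1 \<and> real (dfa_size D1 * dfa_size D2) < t2) \<Longrightarrow>
    lisa_step r Props t1 t2 (Test D1 D2 N) (Convert (add_mset D1 (add_mset D2 N)) {#})"
| convert: "symbolic_rep r Props D A \<Longrightarrow> (\<forall>B \<in># K. state_vars A \<inter> state_vars B = {}) \<Longrightarrow>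
    lisa_step r Props t1 t2 (Convert (add_mset D M) K) (Convert M (add_mset A K))"
| converted: "lisa_step r Props t1 t2 (Convert {#} K) (Symbolic K)"
| sym_compose: "two_least (\<lambda>A. bdd_nodes (sym_trans A)) K A1 A2 N \<Longrightarrow>
    lisa_step r Props t1 t2 (Symbolic K) (Symbolic (add_mset (sym_inter r A1 A2) N))"
| finish: "lisa_step r Props t1 t2 (Symbolic {#A#}) (Return A)"

definition lisa_init :: "'p ltlf list \<Rightarrow> 'p lisa_config" where
  "lisa_init \<phi>s = Decompose \<phi>s {#}"

definition lisa_terminates :: "'p bvar rel \<Rightarrow> 'p set \<Rightarrow> real \<Rightarrow> real \<Rightarrow> 'p ltlf list \<Rightarrow> bool" where
  "lisa_terminates r Props t1 t2 \<phi>s \<longleftrightarrow>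
     \<not> (\<exists>c. c 0 = lisa_init \<phi>s \<and> (\<forall>i :: nat. lisa_step r Props t1 t2 (c i) (c (Suc i))))"

definition lisa_halts_in ::
  "'p bvar rel \<Rightarrow> 'p set \<Rightarrow> real \<Rightarrow> real \<Rightarrow> 'p ltlf list \<Rightarrow> 'p lisa_config \<Rightarrow> bool" where
  "lisa_halts_in r Props t1 t2 \<phi>s c \<longleftrightarrow>
     (lisa_step r Props t1 t2)\<^sup>*\<^sup>* (lisa_init \<phi>s) c \<and> (\<nexists>c'. lisa_step r Props t1 t2 c c')"

end

theory Submission
  imports Defs
begin

text \<open>
  The language of an LTLf formula is regular because the set of subformulas holding at the head of
  a word is determined by the first letter and the corresponding set for the tail; reversing and
  determinizing this finite backward evaluation gives a DFA. Hence minimal DFAs always exist;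
  symbolic representations with fresh variables exist because every Boolean function has a reduced
  ordered BDD. So no configuration other than a returned one is stuck. Every step decreases a linear
  measure of the number of remaining components and preserves the intersection of their languages;
  for symbolic intersection this uses that disjointly encoded DFAs are intersected by conjoining
  their BDDs, the encoding of a pair being the union of the encodings.
\<close>

section \<open>Renaming states\<close>

text \<open>A state is pulled back by \<open>inv_into\<close>, so the transition function is the
  intended one only when \<open>f\<close> is injective on the states; outside the image its value is
  arbitrary.\<close>

definition dfa_rename :: "('s \<Rightarrow> 't) \<Rightarrow> ('a, 's) dfa \<Rightarrow> ('a, 't) dfa" where
  "dfa_rename f D =
     \<lparr>alphabet = alphabet D,
      states = f ` states D,
      initial = f (initial D),
      delta = (\<lambda>s a. f (delta D (inv_into (states D) f s) a)),
      accepting = f ` accepting D\<rparr>"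

lemma foldl_delta_in_states:
  assumes "wf_dfa D" "w \<in> lists (alphabet D)" "s \<in> states D"
  shows "foldl (delta D) s w \<in> states D"
  using assms(2,3)
proof (induction w arbitrary: s rule: list.induct)
  case (Cons a w)
  then show ?case using assms(1) by (simp add: wf_dfa_def)
qed simp

lemma wf_dfa_rename:
  assumes "wf_dfa D" "inj_on f (states D)"
  shows "wf_dfa (dfa_rename f D)"
  using assms by (auto simp: wf_dfa_def dfa_rename_def)

text \<open>Runs of the renamed automaton are the images under \<open>f\<close> of the original
  runs. The state reached stays in \<open>states D\<close>, so injectivity turns membership in the
  image of \<open>accepting D\<close> back into acceptance by \<open>D\<close>.\<close>

lemma dfa_lang_rename:
  assumes "wf_dfa D" "inj_on f (states D)"
  shows "dfa_lang (dfa_rename f D) = dfa_lang D"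
proof -
  have run: "foldl (delta (dfa_rename f D)) (f s) w = f (foldl (delta D) s w)"
    if "w \<in> lists (alphabet D)" "s \<in> states D" for s w
    using that
  proof (induction w arbitrary: s rule: list.induct)
    case (Cons a w)
    have "delta D s a \<in> states D" using Cons.prems assms(1) by (simp add: wf_dfa_def)
    then show ?case using Cons assms(2) by (simp add: dfa_rename_def)
  qed simp
  have i: "initial D \<in> states D" and acc: "accepting D \<subseteq> states D"
    using assms(1) by (auto simp: wf_dfa_def)
  have "foldl (delta (dfa_rename f D)) (initial (dfa_rename f D)) w \<in> accepting (dfa_rename f D) \<longleftrightarrow>
      foldl (delta D) (initial D) w \<in> accepting D" if "w \<in> lists (alphabet D)" for w
  proof -
    have "foldl (delta (dfa_rename f D)) (initial (dfa_rename f D)) w =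
        f (foldl (delta D) (initial D) w)"
      using run[OF that i] by (simp add: dfa_rename_def)
    moreover have "accepting (dfa_rename f D) = f ` accepting D" by (simp add: dfa_rename_def)
    ultimately show ?thesis
      using inj_on_image_mem_iff[OF assms(2) foldl_delta_in_states[OF assms(1) that i] acc] by simp
  qed
  moreover have "alphabet (dfa_rename f D) = alphabet D" by (simp add: dfa_rename_def)
  ultimately show ?thesis unfolding dfa_lang_def by (metis (mono_tags, lifting))
qed

text \<open>The BDDs see states only through their encoding, so precomposing that encoding with the
  inverse of \<open>f\<close> makes the same formulas encode the renamed automaton.\<close>

lemma encodes_rename:
  assumes "encodes r Props A D" "inj_on f (states D)"
  shows "encodes r Props A (dfa_rename f D)"
proof -
  from assms(1)[unfolded encodes_def] obtain e where D: "wf_dfa D" "alphabet D = Pow Props"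
    and A: "finite (state_vars A)" "robdd r (sym_init A)" "bdd_vars (sym_init A) \<subseteq> Cur ` state_vars A"
      "robdd r (sym_trans A)"
      "bdd_vars (sym_trans A) \<subseteq> Cur ` state_vars A \<union> Pr ` Props \<union> Primed ` state_vars A"
      "robdd r (sym_final A)" "bdd_vars (sym_final A) \<subseteq> Cur ` state_vars A"
    and e: "inj_on e (states D)" "e ` states D \<subseteq> Pow (state_vars A)"
      "\<forall>Z \<subseteq> state_vars A. bdd_sat (Cur ` Z) (sym_init A) \<longleftrightarrow> Z = e (initial D)"
      "\<forall>Z \<subseteq> state_vars A. \<forall>P \<subseteq> Props. \<forall>Z' \<subseteq> state_vars A.
         bdd_sat (Cur ` Z \<union> Pr ` P \<union> Primed ` Z') (sym_trans A) \<longleftrightarrow>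
         (\<exists>s \<in> states D. \<exists>s' \<in> states D. e s = Z \<and> e s' = Z' \<and> delta D s P = s')"
      "\<forall>Z \<subseteq> state_vars A. bdd_sat (Cur ` Z) (sym_final A) \<longleftrightarrow>
         (\<exists>s \<in> states D. e s = Z \<and> s \<in> accepting D)"
    by (elim conjE exE) (rule that)
  let ?D = "dfa_rename f D" and ?g = "inv_into (states D) f"
  have g: "?g (f s) = s" if "s \<in> states D" for s using that assms(2) by simp
  have i: "initial D \<in> states D" and acc: "accepting D \<subseteq> states D"
    using D(1) by (auto simp: wf_dfa_def)
  have closed: "delta D s P \<in> states D" if "s \<in> states D" "P \<subseteq> Props" for s P
    using that D by (simp add: wf_dfa_def)
  have sel: "alphabet ?D = alphabet D" "states ?D = f ` states D" "initial ?D = f (initial D)"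
    "accepting ?D = f ` accepting D" "\<And>s a. delta ?D s a = f (delta D (?g s) a)"
    by (simp_all add: dfa_rename_def)
  have "inj_on (e \<circ> ?g) (states ?D)"
    using e(1) by (auto simp: sel inj_on_def g)
  moreover have "(e \<circ> ?g) ` states ?D \<subseteq> Pow (state_vars A)"
    using e(2) by (simp add: sel image_subset_iff g)
  moreover have "\<forall>Z \<subseteq> state_vars A.
      bdd_sat (Cur ` Z) (sym_init A) \<longleftrightarrow> Z = (e \<circ> ?g) (initial ?D)"
    using e(3) i by (simp add: sel g)
  moreover have "\<forall>Z \<subseteq> state_vars A. \<forall>P \<subseteq> Props. \<forall>Z' \<subseteq> state_vars A.
      bdd_sat (Cur ` Z \<union> Pr ` P \<union> Primed ` Z') (sym_trans A) \<longleftrightarrow>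
      (\<exists>s \<in> states ?D. \<exists>s' \<in> states ?D. (e \<circ> ?g) s = Z \<and> (e \<circ> ?g) s' = Z' \<and> delta ?D s P = s')"
    using e(4) closed inj_on_eq_iff[OF assms(2)]
    by (simp add: sel g cong: conj_cong bex_cong)
  moreover have "f s \<in> f ` accepting D \<longleftrightarrow> s \<in> accepting D" if "s \<in> states D" for s
    using that acc assms(2) by (auto dest: inj_onD)
  then have "\<forall>Z \<subseteq> state_vars A. bdd_sat (Cur ` Z) (sym_final A) \<longleftrightarrow>
      (\<exists>s \<in> states ?D. (e \<circ> ?g) s = Z \<and> s \<in> accepting ?D)"
    using e(5) by (simp add: sel g)
  ultimately have "\<exists>enc. inj_on enc (states ?D) \<and> enc ` states ?D \<subseteq> Pow (state_vars A) \<and>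
        (\<forall>Z \<subseteq> state_vars A. bdd_sat (Cur ` Z) (sym_init A) \<longleftrightarrow> Z = enc (initial ?D)) \<and>
        (\<forall>Z \<subseteq> state_vars A. \<forall>P \<subseteq> Props. \<forall>Z' \<subseteq> state_vars A.
           bdd_sat (Cur ` Z \<union> Pr ` P \<union> Primed ` Z') (sym_trans A) \<longleftrightarrow>
           (\<exists>s \<in> states ?D. \<exists>s' \<in> states ?D. enc s = Z \<and> enc s' = Z' \<and> delta ?D s P = s')) \<and>
        (\<forall>Z \<subseteq> state_vars A. bdd_sat (Cur ` Z) (sym_final A) \<longleftrightarrow>
           (\<exists>s \<in> states ?D. enc s = Z \<and> s \<in> accepting ?D))"
    by blast
  moreover have "alphabet ?D = Pow Props" using D(2) sel(1) by simp
  ultimately show ?thesis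
    unfolding encodes_def using wf_dfa_rename[OF D(1) assms(2)] A by blast
qed

text \<open>\<open>symbolic_dfa\<close> and \<open>symbolic_lang\<close> quantify over DFAs on
  natural numbers only. A finite state set of any type embeds into the natural numbers, so a DFA of
  any state type, in particular a product, may serve as witness.\<close>

lemma symbolic_dfaI:
  fixes D :: "('p set, 's) dfa"
  assumes "encodes r Props A D"
  shows "symbolic_dfa r Props A" "symbolic_lang r Props A = dfa_lang D"
proof -
  have wf: "wf_dfa D" using assms by (simp add: encodes_def)
  then obtain f :: "'s \<Rightarrow> nat" where f: "inj_on f (states D)"
    using finite_imp_inj_to_nat_seg[of "states D"] by (auto simp: wf_dfa_def)
  have enc: "encodes r Props A (dfa_rename f D)" by (rule encodes_rename[OF assms f])
  then show "symbolic_dfa r Props A" unfolding symbolic_dfa_def by blast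
  show "symbolic_lang r Props A = dfa_lang D"
    using symbolic_lang_eq[OF enc] dfa_lang_rename[OF wf f] by simp
qed

text \<open>Renaming shows that some DFA on natural numbers has this language; among those, one of
  least size exists because sizes are natural numbers.\<close>

lemma minimal_dfa_exists:
  fixes D :: "('a, 's) dfa"
  assumes "wf_dfa D"
  shows "\<exists>D'. minimal_dfa (alphabet D) (dfa_lang D) D'"
proof -
  obtain f :: "'s \<Rightarrow> nat" where f: "inj_on f (states D)"
    using finite_imp_inj_to_nat_seg[of "states D"] assms by (auto simp: wf_dfa_def)
  let ?P = "\<lambda>D' :: ('a, nat) dfa.
    wf_dfa D' \<and> alphabet D' = alphabet D \<and> dfa_lang D' = dfa_lang D"
  have "?P (dfa_rename f D)"
    using wf_dfa_rename[OF assms f] dfa_lang_rename[OF assms f] by (simp add: dfa_rename_def)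
  from ex_has_least_nat[of ?P, OF this, of dfa_size] show ?thesis
    unfolding minimal_dfa_def by blast
qed

section \<open>Product automata\<close>

lemma wf_dfa_inter:
  assumes "wf_dfa D1" "wf_dfa D2"
  shows "wf_dfa (dfa_inter D1 D2)"
  using assms by (auto simp: wf_dfa_def dfa_inter_def)

lemma dfa_lang_inter: "dfa_lang (dfa_inter D1 D2) = dfa_lang D1 \<inter> dfa_lang D2"
proof -
  have "foldl (delta (dfa_inter D1 D2)) (s, t) w = (foldl (delta D1) s w, foldl (delta D2) t w)"
    for s t w
    by (induction w arbitrary: s t rule: list.induct) (simp_all add: dfa_inter_def)
  moreover have "initial (dfa_inter D1 D2) = (initial D1, initial D2)"
    "alphabet (dfa_inter D1 D2) = alphabet D1 \<inter> alphabet D2"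
    "accepting (dfa_inter D1 D2) = accepting D1 \<times> accepting D2"
    by (simp_all add: dfa_inter_def)
  ultimately show ?thesis by (auto simp: dfa_lang_def)
qed


section \<open>Regularity of LTLf\<close>

text \<open>The value \<open>h w\<close> is computed from the right end of \<open>w\<close>, while a
  DFA reads from the left. A state is therefore a set \<open>Y\<close> of values: those that the
  unread suffix may evaluate to if the whole word is to have a value in \<open>Q\<close>. Reading
  \<open>a\<close> replaces \<open>Y\<close> by its preimage under \<open>g a\<close>, and at the
  end the suffix is empty, so \<open>h []\<close> is tested for membership.\<close>

lemma backward_evaluation_dfa:
  fixes h :: "'a list \<Rightarrow> 'x"
  assumes "finite \<Sigma>" "finite X"
    and h: "\<And>w. w \<in> lists \<Sigma> \<Longrightarrow> h w \<in> X"
    and step: "\<And>a w. a \<in> \<Sigma> \<Longrightarrow> w \<in> lists \<Sigma> \<Longrightarrow> h (a # w) = g a (h w)"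
  shows "\<exists>D :: ('a, 'x set) dfa.
    wf_dfa D \<and> alphabet D = \<Sigma> \<and> dfa_lang D = {w \<in> lists \<Sigma>. h w \<in> Q}"
proof -
  \<comment> \<open>All sets are cut down to \<open>X\<close> so that there are finitely many
    states; nothing is lost since \<open>h\<close> takes its values in \<open>X\<close>.\<close>
  define D where "D = \<lparr>alphabet = \<Sigma>, states = Pow X, initial = Q \<inter> X,
    delta = (\<lambda>Y a. {x \<in> X. g a x \<in> Y}), accepting = {Y \<in> Pow X. h [] \<in> Y}\<rparr>"
  have wf: "wf_dfa D" and al: "alphabet D = \<Sigma>"
    using assms(1,2) by (auto simp: wf_dfa_def D_def)
  have run: "h [] \<in> foldl (delta D) Y w \<longleftrightarrow> h w \<in> Y" if "w \<in> lists \<Sigma>" for Y w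
    using that
  proof (induction w arbitrary: Y rule: list.induct)
    case (Cons a w)
    then have "h [] \<in> foldl (delta D) (delta D Y a) w \<longleftrightarrow> h w \<in> delta D Y a" by simp
    also have "\<dots> \<longleftrightarrow> h (a # w) \<in> Y" using Cons.prems h step by (simp add: D_def)
    finally show ?case by simp
  qed simp
  have sub: "foldl (delta D) (Q \<inter> X) w \<subseteq> X" if "w \<in> lists \<Sigma>" for w
    using foldl_delta_in_states[OF wf, of w "Q \<inter> X"] that by (simp add: D_def)
  have "foldl (delta D) (initial D) w \<in> accepting D \<longleftrightarrow> h w \<in> Q" if "w \<in> lists \<Sigma>" for w
    using run[OF that, of "Q \<inter> X"] sub[OF that] h[OF that] by (simp add: D_def)
  then have "dfa_lang D = {w \<in> lists \<Sigma>. h w \<in> Q}"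
    unfolding dfa_lang_def al by (intro Collect_cong conj_cong refl)
  with wf al show ?thesis by blast
qed

section \<open>Unfolding LTLf at the first letter\<close>

lemma ex_ge_Suc: "(\<exists>j. Suc i \<le> j \<and> P j) \<longleftrightarrow> (\<exists>j. i \<le> j \<and> P (Suc j))"
  by (metis Suc_le_D Suc_le_mono)

lemma all_ge_Suc: "(\<forall>j. Suc i \<le> j \<and> P j \<longrightarrow> Q j) \<longleftrightarrow> (\<forall>j. i \<le> j \<and> P (Suc j) \<longrightarrow> Q (Suc j))"
  by (metis Suc_le_D Suc_le_mono)

text \<open>The truth of a formula at a position depends only on later positions and that one, so
  the first letter is invisible from any successor position.\<close>

lemma ltlf_sat_Suc: "ltlf_sat (a # w) (Suc i) \<phi> \<longleftrightarrow> ltlf_sat w i \<phi>"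
proof (induction \<phi> arbitrary: i)
  case (Until \<phi> \<psi>)
  then show ?case by (simp only: ltlf_sat.simps ex_ge_Suc all_ge_Suc length_Cons Suc_less_eq)
next
  case (Eventually \<phi>)
  then show ?case by (simp only: ltlf_sat.simps ex_ge_Suc length_Cons Suc_less_eq)
next
  case (Always \<phi>)
  then show ?case by (simp only: ltlf_sat.simps all_ge_Suc length_Cons Suc_less_eq)
qed auto

text \<open>This expansion law, like the two after it, also covers the last letter without a case
  distinction: on the empty trace \<open>Until\<close> and \<open>Eventually\<close> are false and
  \<open>Always\<close> is vacuously true, which are the right default values for the missing
  rest.\<close>

lemma ltlf_sat_Until_Cons:
  "ltlf_sat (a # w) 0 (Until \<phi> \<psi>) \<longleftrightarrow>
   ltlf_sat (a # w) 0 \<psi> \<or> ltlf_sat (a # w) 0 \<phi> \<and> ltlf_sat w 0 (Until \<phi> \<psi>)" (is "?l \<longleftrightarrow> ?r")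
proof
  assume ?l
  then obtain j where j: "j < length (a # w)" "ltlf_sat (a # w) j \<psi>"
    "\<forall>k < j. ltlf_sat (a # w) k \<phi>" by auto
  show ?r
  proof (cases j)
    case 0
    then show ?thesis using j by simp
  next
    case (Suc i)
    have "ltlf_sat w k \<phi>" if "k < i" for k
      using j(3)[rule_format, of "Suc k"] that Suc by (simp add: ltlf_sat_Suc)
    then show ?thesis using j Suc by (auto simp: ltlf_sat_Suc)
  qed
next
  assume ?r
  then show ?l
  proof
    assume "ltlf_sat (a # w) 0 \<psi>"
    then show ?l by auto
  next
    assume r: "ltlf_sat (a # w) 0 \<phi> \<and> ltlf_sat w 0 (Until \<phi> \<psi>)"
    then obtain i where i: "i < length w" "ltlf_sat w i \<psi>" "\<forall>k < i. ltlf_sat w k \<phi>" by auto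
    have "ltlf_sat (a # w) k \<phi>" if "k < Suc i" for k
      using r i(3) that by (cases k) (auto simp: ltlf_sat_Suc)
    then show ?l using i by (auto simp: ltlf_sat_Suc intro!: exI[of _ "Suc i"])
  qed
qed

lemma ltlf_sat_Eventually_Cons:
  "ltlf_sat (a # w) 0 (Eventually \<phi>) \<longleftrightarrow>
   ltlf_sat (a # w) 0 \<phi> \<or> ltlf_sat w 0 (Eventually \<phi>)"
proof -
  have "(\<exists>j < Suc (length w). ltlf_sat (a # w) j \<phi>) \<longleftrightarrow>
    ltlf_sat (a # w) 0 \<phi> \<or> (\<exists>j < length w. ltlf_sat (a # w) (Suc j) \<phi>)"
    by (rule Ex_less_Suc2)
  then show ?thesis by (simp add: ltlf_sat_Suc)
qed

lemma ltlf_sat_Always_Cons: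
  "ltlf_sat (a # w) 0 (Always \<phi>) \<longleftrightarrow>
   ltlf_sat (a # w) 0 \<phi> \<and> ltlf_sat w 0 (Always \<phi>)"
proof -
  have "(\<forall>j < Suc (length w). ltlf_sat (a # w) j \<phi>) \<longleftrightarrow>
    ltlf_sat (a # w) 0 \<phi> \<and> (\<forall>j < length w. ltlf_sat (a # w) (Suc j) \<phi>)"
    by (rule All_less_Suc2)
  then show ?thesis by (simp add: ltlf_sat_Suc)
qed

primrec subformulas :: "'p ltlf \<Rightarrow> 'p ltlf set" where
  "subformulas (Atom a) = {Atom a}"
| "subformulas (Not \<phi>) = insert (Not \<phi>) (subformulas \<phi>)"
| "subformulas (And \<phi> \<psi>) = insert (And \<phi> \<psi>) (subformulas \<phi> \<union> subformulas \<psi>)"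
| "subformulas (Or \<phi> \<psi>) = insert (Or \<phi> \<psi>) (subformulas \<phi> \<union> subformulas \<psi>)"
| "subformulas (Next \<phi>) = insert (Next \<phi>) (subformulas \<phi>)"
| "subformulas (Until \<phi> \<psi>) = insert (Until \<phi> \<psi>) (subformulas \<phi> \<union> subformulas \<psi>)"
| "subformulas (Eventually \<phi>) = insert (Eventually \<phi>) (subformulas \<phi>)"
| "subformulas (Always \<phi>) = insert (Always \<phi>) (subformulas \<phi>)"

lemma finite_subformulas: "finite (subformulas \<phi>)"
  by (induction \<phi>) simp_all

lemma subformulas_self: "\<phi> \<in> subformulas \<phi>"
  by (cases \<phi>) simp_all

text \<open>\<open>ltlf_back a b T \<phi>\<close> evaluates \<open>\<phi>\<close> at a letter \<open>a\<close>, given the set \<open>T\<close> of formulas holding on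
  the rest of the word; \<open>b\<close> tells whether that rest is nonempty.\<close>

primrec ltlf_back :: "'p set \<Rightarrow> bool \<Rightarrow> 'p ltlf set \<Rightarrow> 'p ltlf \<Rightarrow> bool" where
  "ltlf_back a b T (Atom p) \<longleftrightarrow> p \<in> a"
| "ltlf_back a b T (Not \<phi>) \<longleftrightarrow> \<not> ltlf_back a b T \<phi>"
| "ltlf_back a b T (And \<phi> \<psi>) \<longleftrightarrow> ltlf_back a b T \<phi> \<and> ltlf_back a b T \<psi>"
| "ltlf_back a b T (Or \<phi> \<psi>) \<longleftrightarrow> ltlf_back a b T \<phi> \<or> ltlf_back a b T \<psi>"
| "ltlf_back a b T (Next \<phi>) \<longleftrightarrow> b \<and> \<phi> \<in> T"
| "ltlf_back a b T (Until \<phi> \<psi>) \<longleftrightarrow>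
     ltlf_back a b T \<psi> \<or> ltlf_back a b T \<phi> \<and> Until \<phi> \<psi> \<in> T"
| "ltlf_back a b T (Eventually \<phi>) \<longleftrightarrow> ltlf_back a b T \<phi> \<or> Eventually \<phi> \<in> T"
| "ltlf_back a b T (Always \<phi>) \<longleftrightarrow> ltlf_back a b T \<phi> \<and> Always \<phi> \<in> T"

text \<open>\<open>S\<close> is any superset of the subformulas, so that it stays fixed when the
  induction descends. Nonemptiness of the rest must be supplied separately for \<open>Next\<close>:
  a formula such as a negated atom holds on the empty trace, yet \<open>Next\<close> of it fails at
  the last letter.\<close>

lemma ltlf_sat_Cons:
  assumes "subformulas \<phi> \<subseteq> S"
  shows "ltlf_sat (a # w) 0 \<phi> \<longleftrightarrow> ltlf_back a (w \<noteq> []) {\<psi> \<in> S. ltlf_sat w 0 \<psi>} \<phi>"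
  using assms
proof (induction \<phi>)
  case (Next \<phi>)
  then show ?case using subformulas_self[of \<phi>] by (auto simp: ltlf_sat_Suc)
next
  case (Until \<phi> \<psi>)
  then show ?case
    by (simp only: ltlf_sat_Until_Cons ltlf_back.simps) auto
next
  case (Eventually \<phi>)
  then show ?case
    by (simp only: ltlf_sat_Eventually_Cons ltlf_back.simps) auto
next
  case (Always \<phi>)
  then show ?case
    by (simp only: ltlf_sat_Always_Cons ltlf_back.simps) auto
qed auto

lemma ltlf_dfa_exists:
  fixes \<phi> :: "'p ltlf"
  assumes "finite Props"
  shows "\<exists>D. minimal_dfa (Pow Props) (ltlf_lang Props \<phi>) D"
proof -
  define S where "S = subformulas \<phi>"
  \<comment> \<open>The first component is needed for \<open>Next\<close> and also to reject the
    empty word, on which the formula itself may evaluate to true.\<close>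
  define h where "h w = (w \<noteq> [], {\<psi> \<in> S. ltlf_sat w 0 \<psi>})" for w
  define g where "g a x = (True, {\<psi> \<in> S. ltlf_back a (fst x) (snd x) \<psi>})" for a x
  \<comment> \<open>\<open>S\<close> is closed under subformulas, hence \<open>ltlf_sat_Cons\<close>
    applies to each of its members and not only to the whole formula.\<close>
  have trans: "subformulas \<psi> \<subseteq> subformulas \<chi>" if "\<psi> \<in> subformulas \<chi>" for \<psi> \<chi> :: "'p ltlf"
    using that by (induction \<chi>) auto
  have step: "h (a # w) = g a (h w)" for a w
  proof -
    have "ltlf_sat (a # w) 0 \<psi> \<longleftrightarrow> ltlf_back a (w \<noteq> []) {\<psi> \<in> S. ltlf_sat w 0 \<psi>} \<psi>"
      if "\<psi> \<in> S" for \<psi>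
      by (rule ltlf_sat_Cons) (use that trans in \<open>simp add: S_def\<close>)
    then show ?thesis unfolding h_def g_def by auto
  qed
  obtain D :: "('p set, (bool \<times> 'p ltlf set) set) dfa" where
    D: "wf_dfa D" "alphabet D = Pow Props"
      "dfa_lang D = {w \<in> lists (Pow Props). h w \<in> {x. fst x \<and> \<phi> \<in> snd x}}"
    using backward_evaluation_dfa[of "Pow Props" "UNIV \<times> Pow S" h g "{x. fst x \<and> \<phi> \<in> snd x}"]
      step assms finite_subformulas[of \<phi>]
    by (auto simp: S_def h_def)
  have "dfa_lang D = ltlf_lang Props \<phi>"
    unfolding D(3) ltlf_lang_def h_def S_def using subformulas_self[of \<phi>] by auto
  then show ?thesis using minimal_dfa_exists[OF D(1)] D(2) by simp
qed

lemma ltlf_lang_Conj: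
  assumes "\<phi>s \<noteq> []"
  shows "ltlf_lang Props (ltlf_Conj \<phi>s) = (\<Inter>\<phi> \<in> set \<phi>s. ltlf_lang Props \<phi>)"
  using assms
  by (induction \<phi>s rule: ltlf_Conj.induct) (auto simp: ltlf_lang_def)


section \<open>BDDs\<close>

lemma bdd_sat_cong: "I \<inter> bdd_vars b = J \<inter> bdd_vars b \<Longrightarrow> bdd_sat I b \<longleftrightarrow> bdd_sat J b"
proof (induction b)
  case (Ite v b c)
  have "I \<inter> bdd_vars b = J \<inter> bdd_vars b" "I \<inter> bdd_vars c = J \<inter> bdd_vars c" "v \<in> I \<longleftrightarrow> v \<in> J"
    using Ite.prems by auto
  then show ?case using Ite.IH by simp
qed simp

lemma bdd_sat_mk [simp]: "bdd_sat I (bdd_mk v b c) \<longleftrightarrow> (if v \<in> I then bdd_sat I b else bdd_sat I c)"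
  by (simp add: bdd_mk_def)

lemma bdd_vars_mk: "bdd_vars (bdd_mk v b c) \<subseteq> insert v (bdd_vars b \<union> bdd_vars c)"
  by (auto simp: bdd_mk_def)

text \<open>The inequality of the two children demanded by \<open>robdd\<close> comes from
  \<open>bdd_mk\<close> itself, which returns the common child when they coincide.\<close>

lemma robdd_mk:
  assumes "robdd r b" "robdd r c" "\<forall>u \<in> bdd_vars b \<union> bdd_vars c. u \<noteq> v \<and> (v, u) \<in> r"
  shows "robdd r (bdd_mk v b c)"
  using assms by (simp add: bdd_mk_def)

lemma bdd_sat_conj: "bdd_sat I (bdd_conj r b c) \<longleftrightarrow> bdd_sat I b \<and> bdd_sat I c"
  by (induction r b c rule: bdd_conj.induct) auto

lemma bdd_vars_conj: "bdd_vars (bdd_conj r b c) \<subseteq> bdd_vars b \<union> bdd_vars c"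
proof (induction r b c rule: bdd_conj.induct)
  case (3 r u b1 c1 v b2 c2)
  show ?case
  proof (cases "u = v")
    case True
    then show ?thesis using 3(1,2) bdd_vars_mk[of u] by fastforce
  next
    case False
    show ?thesis
    proof (cases "(u, v) \<in> r")
      case True
      then show ?thesis using 3(3,4) False bdd_vars_mk[of u] by fastforce
    next
      case False
      then show ?thesis using 3(5,6) \<open>u \<noteq> v\<close> bdd_vars_mk[of v] by fastforce
    qed
  qed
qed auto

text \<open>\<open>bdd_conj\<close> always branches on the smaller of the two root variables. By
  \<open>bdd_vars_conj\<close> the recursive results contain only variables of the arguments below
  that branching, and all of these come strictly later in the order.\<close>

lemma robdd_conj:
  assumes "linear_order r" "robdd r b" "robdd r c"
  shows "robdd r (bdd_conj r b c)"
  using assms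
proof (induction r b c rule: bdd_conj.induct)
  case (3 r u b1 c1 v b2 c2)
  have tr: "(x, z) \<in> r" if "(x, y) \<in> r" "(y, z) \<in> r" for x y z
    using 3(7) that by (auto simp: order_on_defs elim: transE)
  have as: "x = y" if "(x, y) \<in> r" "(y, x) \<in> r" for x y
    using 3(7) that by (auto simp: order_on_defs dest: antisymD)
  have tot: "(x, y) \<in> r \<or> (y, x) \<in> r" if "x \<noteq> y" for x y
    using 3(7) that by (auto simp: order_on_defs total_on_def)
  have u: "\<forall>x \<in> bdd_vars b1 \<union> bdd_vars c1. x \<noteq> u \<and> (u, x) \<in> r"
    and v: "\<forall>x \<in> bdd_vars b2 \<union> bdd_vars c2. x \<noteq> v \<and> (v, x) \<in> r"
    and rb: "robdd r b1" "robdd r c1" "robdd r b2" "robdd r c2"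
    using 3(8,9) by simp_all
  have mk: "robdd r (bdd_mk x (bdd_conj r b c) (bdd_conj r b' c'))"
    if "robdd r (bdd_conj r b c)" "robdd r (bdd_conj r b' c')"
      "\<forall>y \<in> bdd_vars b \<union> bdd_vars b'. y \<noteq> x \<and> (x, y) \<in> r"
      "\<forall>y \<in> bdd_vars c \<union> bdd_vars c'. y \<noteq> x \<and> (x, y) \<in> r" for x b c b' c'
    using that bdd_vars_conj[of r b c] bdd_vars_conj[of r b' c'] by (intro robdd_mk) auto
  \<comment> \<open>If \<open>z\<close> were equal to \<open>x\<close>, then \<open>x\<close> and
    \<open>y\<close> would precede each other, so antisymmetry would give \<open>z = y\<close>,
    which is excluded.\<close>
  have below: "\<forall>z \<in> X. z \<noteq> x \<and> (x, z) \<in> r"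
    if "\<forall>z \<in> X. z \<noteq> y \<and> (y, z) \<in> r" "(x, y) \<in> r" for x y X
    using that tr as by metis
  show ?case
  proof (cases "u = v")
    case True
    have "robdd r (bdd_mk u (bdd_conj r b1 b2) (bdd_conj r c1 c2))"
      using mk[OF 3(1)[OF True 3(7) rb(1,3)] 3(2)[OF True 3(7) rb(2,4)] u] v True by simp
    then show ?thesis using True by simp
  next
    case ne: False
    show ?thesis
    proof (cases "(u, v) \<in> r")
      case True
      have "\<forall>x \<in> bdd_vars (Ite v b2 c2). x \<noteq> u \<and> (u, x) \<in> r"
        using below[OF v True] True ne by simp
      then have "robdd r (bdd_mk u (bdd_conj r b1 (Ite v b2 c2)) (bdd_conj r c1 (Ite v b2 c2)))"
        using mk[OF 3(3)[OF ne True 3(7) rb(1) 3(9)] 3(4)[OF ne True 3(7) rb(2) 3(9)] u] by simp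
      then show ?thesis using True ne by simp
    next
      case False
      then have vu: "(v, u) \<in> r" using tot ne by blast
      have "\<forall>x \<in> bdd_vars (Ite u b1 c1). x \<noteq> v \<and> (v, x) \<in> r"
        using below[OF u vu] vu ne by simp
      then have "robdd r (bdd_mk v (bdd_conj r (Ite u b1 c1) b2) (bdd_conj r (Ite u b1 c1) c2))"
        using mk[OF 3(5)[OF ne False 3(7,8) rb(3)] 3(6)[OF ne False 3(7,8) rb(4)] _ v] by simp
      then show ?thesis using False ne by simp
    qed
  qed
qed auto

section \<open>Every Boolean function of finitely many variables has a reduced ordered BDD\<close>

lemma finite_linear_order_least:
  assumes "linear_order r" "finite V" "V \<noteq> {}"
  shows "\<exists>v \<in> V. \<forall>u \<in> V. (v, u) \<in> r"
  using assms(2,3)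
proof (induction V rule: finite_ne_induct)
  case (singleton x)
  then show ?case using assms(1) by (auto simp: order_on_defs refl_on_def)
next
  case (insert x V)
  then obtain v where v: "v \<in> V" "\<forall>u \<in> V. (v, u) \<in> r" by blast
  have rfl: "(y, y) \<in> r" for y using assms(1) by (auto simp: order_on_defs refl_on_def)
  have "(x, v) \<in> r \<or> (v, x) \<in> r"
    using assms(1) rfl by (cases "x = v") (auto simp: order_on_defs total_on_def)
  then show ?case
  proof
    assume "(x, v) \<in> r"
    then have "\<forall>u \<in> V. (x, u) \<in> r"
      using v assms(1) by (auto simp: order_on_defs elim: transE)
    then show ?thesis using rfl by blast
  next
    assume "(v, x) \<in> r"
    then show ?thesis using v by blast
  qed
qed

text \<open>Shannon expansion at the least variable of \<open>V\<close>. The function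
  \<open>f\<close> is generalized in the induction because the two branches represent its two
  cofactors.\<close>

lemma robdd_exists:
  assumes "linear_order r" "finite V"
  shows "\<exists>b. robdd r b \<and> bdd_vars b \<subseteq> V \<and> (\<forall>I \<subseteq> V. bdd_sat I b \<longleftrightarrow> f I)"
  using assms(2)
proof (induction "card V" arbitrary: V f)
  case 0
  then show ?case by (intro exI[of _ "Const (f {})"]) auto
next
  case (Suc n)
  then obtain v where v: "v \<in> V" "\<forall>u \<in> V. (v, u) \<in> r"
    using finite_linear_order_least[OF assms(1), of V] by fastforce
  let ?W = "V - {v}"
  have W: "n = card ?W" "finite ?W" using Suc v by auto
  obtain b where b: "robdd r b" "bdd_vars b \<subseteq> ?W" "\<forall>I \<subseteq> ?W. bdd_sat I b \<longleftrightarrow> f (insert v I)"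
    using Suc(1)[OF W, of "\<lambda>I. f (insert v I)"] by blast
  obtain c where c: "robdd r c" "bdd_vars c \<subseteq> ?W" "\<forall>I \<subseteq> ?W. bdd_sat I c \<longleftrightarrow> f I"
    using Suc(1)[OF W, of f] by blast
  have "bdd_sat I (bdd_mk v b c) \<longleftrightarrow> f I" if "I \<subseteq> V" for I
  proof (cases "v \<in> I")
    case True
    \<comment> \<open>The specification of \<open>b\<close> speaks only of interpretations without
      \<open>v\<close>; since \<open>v\<close> does not occur in \<open>b\<close>, it may be deleted
      from \<open>I\<close> first.\<close>
    have "bdd_sat I b \<longleftrightarrow> bdd_sat (I - {v}) b" by (rule bdd_sat_cong) (use b(2) in blast)
    also have "\<dots> \<longleftrightarrow> f (insert v (I - {v}))"
      by (rule b(3)[rule_format]) (use that in blast)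
    finally show ?thesis using True by (simp add: insert_absorb)
  next
    case False
    then have "I \<subseteq> ?W" using that by blast
    from c(3)[rule_format, OF this] False show ?thesis by simp
  qed
  moreover have "robdd r (bdd_mk v b c)"
    by (rule robdd_mk[OF b(1) c(1)]) (use b(2) c(2) v(2) in blast)
  moreover have "bdd_vars (bdd_mk v b c) \<subseteq> V" using bdd_vars_mk[of v b c] b(2) c(2) v(1) by blast
  ultimately show ?case by (intro exI[of _ "bdd_mk v b c"]) simp
qed


section \<open>Symbolic representations\<close>

text \<open>With \<open>k\<close> variables there are \<open>2 ^ k\<close> interpretations, at least
  as many as states, so an injective encoding exists; the three formulas are then instances of
  \<open>robdd_exists\<close>. The set \<open>W\<close> stands for variables already in use.\<close>

lemma symbolic_rep_exists:
  fixes D :: "('p set, 's) dfa"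
  assumes "linear_order r" "finite Props" "wf_dfa D" "alphabet D = Pow Props" "finite W"
  shows "\<exists>A. symbolic_rep r Props D A \<and> state_vars A \<inter> W = {}"
proof -
  define n where "n = card (states D)"
  define k where "k = nat \<lceil>log 2 (real n)\<rceil>"
  have fin: "finite (states D)" and i: "initial D \<in> states D"
    using assms(3) by (auto simp: wf_dfa_def)
  \<comment> \<open>The initial state makes the logarithm nonnegative, so the conversion by
    \<open>nat\<close> in \<open>k\<close> loses nothing. A single state gives \<open>k = 0\<close>
    and no variables at all.\<close>
  have n: "n \<ge> 1" using fin i unfolding n_def by (metis One_nat_def Suc_leI card_gt_0_iff empty_iff)
  then have "log 2 (real n) \<ge> 0" by simp
  then have k: "int k = \<lceil>log 2 (real n)\<rceil>" by (simp add: k_def)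
  have "log 2 (real n) \<le> real k" using k by linarith
  then have "real n \<le> 2 powr real k" using n by (subst (asm) log_le_iff) auto
  also have "\<dots> = real (2 ^ k)" by (simp add: powr_realpow)
  finally have nk: "n \<le> 2 ^ k" by (simp only: of_nat_le_iff)
  obtain V :: "nat set" where V: "finite V" "card V = k" "V \<subseteq> - W"
    using infinite_arbitrarily_large[of "- W" k] assms(5) by auto
  have "card (states D) \<le> card (Pow V)" using nk V by (simp add: card_Pow n_def)
  then obtain e where e: "e ` states D \<subseteq> Pow V" "inj_on e (states D)"
    using card_le_inj[of "states D" "Pow V"] fin V(1) by auto
  \<comment> \<open>Preimages under the three constructors recover current state, letter and next
    state from one interpretation; this is how the functions handed to \<open>robdd_exists\<close>
    are phrased.\<close>
  have pre: "Cur -` (Cur ` Z) = Z" "Cur -` (Cur ` Z \<union> Pr ` P \<union> Primed ` Z') = Z"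
    "Pr -` (Cur ` Z \<union> Pr ` P \<union> Primed ` Z') = P" "Primed -` (Cur ` Z \<union> Pr ` P \<union> Primed ` Z') = Z'"
    for Z Z' and P :: "'p set"
    by auto
  obtain bi :: "'p bvar bdd" where bi: "robdd r bi" "bdd_vars bi \<subseteq> Cur ` V"
    "\<forall>I \<subseteq> Cur ` V. bdd_sat I bi \<longleftrightarrow> Cur -` I = e (initial D)"
    using robdd_exists[OF assms(1) finite_imageI[OF V(1), of Cur],
      where f = "\<lambda>I. Cur -` I = e (initial D)"]
    by (elim exE conjE) (rule that)
  obtain bf :: "'p bvar bdd" where bf: "robdd r bf" "bdd_vars bf \<subseteq> Cur ` V"
    "\<forall>I \<subseteq> Cur ` V. bdd_sat I bf \<longleftrightarrow> (\<exists>s \<in> states D. e s = Cur -` I \<and> s \<in> accepting D)"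
    using robdd_exists[OF assms(1) finite_imageI[OF V(1), of Cur],
      where f = "\<lambda>I. \<exists>s \<in> states D. e s = Cur -` I \<and> s \<in> accepting D"]
    by (elim exE conjE) (rule that)
  let ?T = "Cur ` V \<union> Pr ` Props \<union> Primed ` V"
  let ?f = "\<lambda>I. \<exists>s \<in> states D. \<exists>s' \<in> states D.
    e s = Cur -` I \<and> e s' = Primed -` I \<and> delta D s (Pr -` I) = s'"
  have finT: "finite ?T" using V(1) assms(2) by simp
  obtain bt :: "'p bvar bdd" where bt: "robdd r bt" "bdd_vars bt \<subseteq> ?T"
    "\<forall>I \<subseteq> ?T. bdd_sat I bt \<longleftrightarrow> ?f I"
    using robdd_exists[OF assms(1) finT, where f = ?f] by (elim exE conjE) (rule that)
  define A where "A = \<lparr>state_vars = V, sym_init = bi, sym_trans = bt, sym_final = bf\<rparr>"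
  have "bdd_sat (Cur ` Z) bi \<longleftrightarrow> Z = e (initial D)" if "Z \<subseteq> V" for Z
    using bi(3)[rule_format, of "Cur ` Z"] that by (simp add: image_mono pre)
  moreover have "bdd_sat (Cur ` Z) bf \<longleftrightarrow> (\<exists>s \<in> states D. e s = Z \<and> s \<in> accepting D)"
    if "Z \<subseteq> V" for Z
    using bf(3)[rule_format, of "Cur ` Z"] that by (simp add: image_mono pre)
  moreover have "bdd_sat (Cur ` Z \<union> Pr ` P \<union> Primed ` Z') bt \<longleftrightarrow>
      (\<exists>s \<in> states D. \<exists>s' \<in> states D. e s = Z \<and> e s' = Z' \<and> delta D s P = s')"
    if "Z \<subseteq> V" "P \<subseteq> Props" "Z' \<subseteq> V" for Z P Z'
  proof -
    have "Cur ` Z \<union> Pr ` P \<union> Primed ` Z' \<subseteq> ?T" using that by blast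
    from bt(3)[rule_format, OF this] show ?thesis by (simp only: pre)
  qed
  ultimately have "encodes r Props A D"
    unfolding encodes_def using assms(3,4) V(1) bi(1,2) bt(1,2) bf(1,2) e
    by (intro conjI exI[of _ e]) (simp_all add: A_def)
  moreover have "int (card (state_vars A)) = \<lceil>log 2 (real (dfa_size D))\<rceil>"
    using k V(2) by (simp add: A_def dfa_size_def n_def)
  moreover have "state_vars A \<inter> W = {}" using V(3) by (auto simp: A_def)
  ultimately show ?thesis unfolding symbolic_rep_def by blast
qed

text \<open>Each conjunct constrains only its own half of the state variables, so the components
  move independently; the propositions are shared, which forces both automata to read the same
  letter.\<close>

lemma encodes_inter:
  assumes "linear_order r" "encodes r Props A1 D1" "encodes r Props A2 D2"
    and disj: "state_vars A1 \<inter> state_vars A2 = {}"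
  shows "encodes r Props (sym_inter r A1 A2) (dfa_inter D1 D2)"
proof -
  from assms(2)[unfolded encodes_def] obtain e1 where D1: "wf_dfa D1" "alphabet D1 = Pow Props"
    and A1: "finite (state_vars A1)" "robdd r (sym_init A1)"
      "bdd_vars (sym_init A1) \<subseteq> Cur ` state_vars A1"
      "robdd r (sym_trans A1)"
      "bdd_vars (sym_trans A1) \<subseteq> Cur ` state_vars A1 \<union> Pr ` Props \<union> Primed ` state_vars A1"
      "robdd r (sym_final A1)" "bdd_vars (sym_final A1) \<subseteq> Cur ` state_vars A1"
    and e1: "inj_on e1 (states D1)" "e1 ` states D1 \<subseteq> Pow (state_vars A1)"
      "\<forall>Z \<subseteq> state_vars A1. bdd_sat (Cur ` Z) (sym_init A1) \<longleftrightarrow> Z = e1 (initial D1)"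
      "\<forall>Z \<subseteq> state_vars A1. \<forall>P \<subseteq> Props. \<forall>Z' \<subseteq> state_vars A1.
         bdd_sat (Cur ` Z \<union> Pr ` P \<union> Primed ` Z') (sym_trans A1) \<longleftrightarrow>
         (\<exists>s \<in> states D1. \<exists>s' \<in> states D1. e1 s = Z \<and> e1 s' = Z' \<and> delta D1 s P = s')"
      "\<forall>Z \<subseteq> state_vars A1. bdd_sat (Cur ` Z) (sym_final A1) \<longleftrightarrow>
         (\<exists>s \<in> states D1. e1 s = Z \<and> s \<in> accepting D1)"
    by (elim conjE exE) (rule that)
  from assms(3)[unfolded encodes_def] obtain e2 where D2: "wf_dfa D2" "alphabet D2 = Pow Props"
    and A2: "finite (state_vars A2)" "robdd r (sym_init A2)"
      "bdd_vars (sym_init A2) \<subseteq> Cur ` state_vars A2"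
      "robdd r (sym_trans A2)"
      "bdd_vars (sym_trans A2) \<subseteq> Cur ` state_vars A2 \<union> Pr ` Props \<union> Primed ` state_vars A2"
      "robdd r (sym_final A2)" "bdd_vars (sym_final A2) \<subseteq> Cur ` state_vars A2"
    and e2: "inj_on e2 (states D2)" "e2 ` states D2 \<subseteq> Pow (state_vars A2)"
      "\<forall>Z \<subseteq> state_vars A2. bdd_sat (Cur ` Z) (sym_init A2) \<longleftrightarrow> Z = e2 (initial D2)"
      "\<forall>Z \<subseteq> state_vars A2. \<forall>P \<subseteq> Props. \<forall>Z' \<subseteq> state_vars A2.
         bdd_sat (Cur ` Z \<union> Pr ` P \<union> Primed ` Z') (sym_trans A2) \<longleftrightarrow>
         (\<exists>s \<in> states D2. \<exists>s' \<in> states D2. e2 s = Z \<and> e2 s' = Z' \<and> delta D2 s P = s')"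
      "\<forall>Z \<subseteq> state_vars A2. bdd_sat (Cur ` Z) (sym_final A2) \<longleftrightarrow>
         (\<exists>s \<in> states D2. e2 s = Z \<and> s \<in> accepting D2)"
    by (elim conjE exE) (rule that)
  let ?V1 = "state_vars A1" and ?V2 = "state_vars A2"
  let ?A = "sym_inter r A1 A2" and ?D = "dfa_inter D1 D2"
  define e where "e = (\<lambda>(s, t). e1 s \<union> e2 t)"
  \<comment> \<open>Disjointness makes the union reversible: intersecting with either variable set
    gives back the code of that component. Injectivity of \<open>e\<close> and all three
    equivalences rest on this.\<close>
  have split: "e1 s \<union> e2 t = Z \<longleftrightarrow> e1 s = Z \<inter> ?V1 \<and> e2 t = Z \<inter> ?V2"
    if "s \<in> states D1" "t \<in> states D2" "Z \<subseteq> ?V1 \<union> ?V2" for s t Z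
  proof -
    have "e1 s \<subseteq> ?V1" "e2 t \<subseteq> ?V2" using e1(2) e2(2) that by blast+
    then show ?thesis using disj that(3) by blast
  qed
  have i: "initial D1 \<in> states D1" "initial D2 \<in> states D2"
    using D1(1) D2(1) by (auto simp: wf_dfa_def)
  \<comment> \<open>An interpretation of the joint variables may be restricted to those of one
    component before the specification of that component's BDD is applied.\<close>
  have cur: "bdd_sat (Cur ` Z) b \<longleftrightarrow> bdd_sat (Cur ` (Z \<inter> V)) b"
    if "bdd_vars b \<subseteq> Cur ` V" for Z V and b :: "'a bvar bdd"
    by (rule bdd_sat_cong) (use that in blast)
  have tri: "bdd_sat (Cur ` Z \<union> Pr ` P \<union> Primed ` Z') b \<longleftrightarrow>
      bdd_sat (Cur ` (Z \<inter> V) \<union> Pr ` P \<union> Primed ` (Z' \<inter> V)) b"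
    if "bdd_vars b \<subseteq> Cur ` V \<union> Pr ` Props \<union> Primed ` V" for Z Z' V P and b :: "'a bvar bdd"
    by (rule bdd_sat_cong) (use that in blast)
  have init: "bdd_sat (Cur ` Z) (sym_init ?A) \<longleftrightarrow> Z = e (initial ?D)" if Z: "Z \<subseteq> ?V1 \<union> ?V2" for Z
  proof -
    have "bdd_sat (Cur ` Z) (sym_init ?A) \<longleftrightarrow>
        bdd_sat (Cur ` (Z \<inter> ?V1)) (sym_init A1) \<and> bdd_sat (Cur ` (Z \<inter> ?V2)) (sym_init A2)"
      using cur[OF A1(3)] cur[OF A2(3)] by (simp add: sym_inter_def bdd_sat_conj)
    also have "\<dots> \<longleftrightarrow> Z \<inter> ?V1 = e1 (initial D1) \<and> Z \<inter> ?V2 = e2 (initial D2)"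
      using e1(3) e2(3) by simp
    also have "\<dots> \<longleftrightarrow> Z = e (initial ?D)"
      using split[OF i Z] by (auto simp: e_def dfa_inter_def)
    finally show ?thesis .
  qed
  have final: "bdd_sat (Cur ` Z) (sym_final ?A) \<longleftrightarrow> (\<exists>s \<in> states ?D. e s = Z \<and> s \<in> accepting ?D)"
    if Z: "Z \<subseteq> ?V1 \<union> ?V2" for Z
  proof -
    have "bdd_sat (Cur ` Z) (sym_final ?A) \<longleftrightarrow>
        bdd_sat (Cur ` (Z \<inter> ?V1)) (sym_final A1) \<and> bdd_sat (Cur ` (Z \<inter> ?V2)) (sym_final A2)"
      using cur[OF A1(7)] cur[OF A2(7)] by (simp add: sym_inter_def bdd_sat_conj)
    also have "\<dots> \<longleftrightarrow> (\<exists>s \<in> states D1. e1 s = Z \<inter> ?V1 \<and> s \<in> accepting D1) \<and>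
        (\<exists>t \<in> states D2. e2 t = Z \<inter> ?V2 \<and> t \<in> accepting D2)"
      using e1(5) e2(5) by simp
    also have "\<dots> \<longleftrightarrow> (\<exists>s \<in> states D1. \<exists>t \<in> states D2.
        e1 s \<union> e2 t = Z \<and> s \<in> accepting D1 \<and> t \<in> accepting D2)"
      using split[OF _ _ Z] by metis
    also have "\<dots> \<longleftrightarrow> (\<exists>s \<in> states ?D. e s = Z \<and> s \<in> accepting ?D)"
      by (auto simp: e_def dfa_inter_def)
    finally show ?thesis .
  qed
  have trans: "bdd_sat (Cur ` Z \<union> Pr ` P \<union> Primed ` Z') (sym_trans ?A) \<longleftrightarrow>
      (\<exists>s \<in> states ?D. \<exists>s' \<in> states ?D. e s = Z \<and> e s' = Z' \<and> delta ?D s P = s')"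
    if Z: "Z \<subseteq> ?V1 \<union> ?V2" and P: "P \<subseteq> Props" and Z': "Z' \<subseteq> ?V1 \<union> ?V2" for Z P Z'
  proof -
    have "bdd_sat (Cur ` Z \<union> Pr ` P \<union> Primed ` Z') (sym_trans ?A) \<longleftrightarrow>
        bdd_sat (Cur ` (Z \<inter> ?V1) \<union> Pr ` P \<union> Primed ` (Z' \<inter> ?V1)) (sym_trans A1) \<and>
        bdd_sat (Cur ` (Z \<inter> ?V2) \<union> Pr ` P \<union> Primed ` (Z' \<inter> ?V2)) (sym_trans A2)"
      using tri[OF A1(5)] tri[OF A2(5)] by (simp add: sym_inter_def bdd_sat_conj)
    also have "\<dots> \<longleftrightarrow>
        (\<exists>s \<in> states D1. \<exists>s' \<in> states D1. e1 s = Z \<inter> ?V1 \<and> e1 s' = Z' \<inter> ?V1 \<and> delta D1 s P = s') \<and>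
        (\<exists>t \<in> states D2. \<exists>t' \<in> states D2. e2 t = Z \<inter> ?V2 \<and> e2 t' = Z' \<inter> ?V2 \<and> delta D2 t P = t')"
      using e1(4) e2(4) P by simp
    also have "\<dots> \<longleftrightarrow> (\<exists>s \<in> states D1. \<exists>t \<in> states D2. \<exists>s' \<in> states D1. \<exists>t' \<in> states D2.
        e1 s \<union> e2 t = Z \<and> e1 s' \<union> e2 t' = Z' \<and> delta D1 s P = s' \<and> delta D2 t P = t')"
      by (simp add: split[OF _ _ Z] split[OF _ _ Z'] cong: bex_cong conj_cong) blast
    also have "\<dots> \<longleftrightarrow> (\<exists>s \<in> states ?D. \<exists>s' \<in> states ?D. e s = Z \<and> e s' = Z' \<and> delta ?D s P = s')"
      by (auto simp: e_def dfa_inter_def)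
    finally show ?thesis .
  qed
  have ran: "e ` states ?D \<subseteq> Pow (?V1 \<union> ?V2)"
  proof -
    have "e1 s \<union> e2 t \<subseteq> ?V1 \<union> ?V2" if "s \<in> states D1" "t \<in> states D2" for s t
      using e1(2) e2(2) that by blast
    then show ?thesis by (auto simp: e_def dfa_inter_def)
  qed
  have inj: "inj_on e (states ?D)"
  proof (rule inj_onI)
    fix x y assume "x \<in> states ?D" "y \<in> states ?D" "e x = e y"
    then obtain s t s' t' where x: "x = (s, t)" "s \<in> states D1" "t \<in> states D2"
      and y: "y = (s', t')" "s' \<in> states D1" "t' \<in> states D2" and eq: "e1 s \<union> e2 t = e1 s' \<union> e2 t'"
      by (auto simp: e_def dfa_inter_def)
    have sub: "e1 s \<union> e2 t \<subseteq> ?V1 \<union> ?V2" using e1(2) e2(2) x by blast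
    from split[OF x(2,3) sub] split[OF y(2,3) sub] eq have "e1 s = e1 s'" "e2 t = e2 t'" by auto
    then show "x = y" using x y e1(1) e2(1) by (auto dest: inj_onD)
  qed
  have vars: "state_vars ?A = ?V1 \<union> ?V2" by (simp add: sym_inter_def)
  have robdds: "robdd r (sym_init ?A)" "robdd r (sym_trans ?A)" "robdd r (sym_final ?A)"
    using A1 A2 assms(1) by (auto simp: sym_inter_def intro: robdd_conj)
  have "bdd_vars (sym_init ?A) \<subseteq> Cur ` (?V1 \<union> ?V2)"
    using A1(3) A2(3) bdd_vars_conj[of r "sym_init A1" "sym_init A2"]
    by (simp add: sym_inter_def) blast
  moreover have "bdd_vars (sym_final ?A) \<subseteq> Cur ` (?V1 \<union> ?V2)"
    using A1(7) A2(7) bdd_vars_conj[of r "sym_final A1" "sym_final A2"]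
    by (simp add: sym_inter_def) blast
  moreover have "bdd_vars (sym_trans ?A) \<subseteq>
      Cur ` (?V1 \<union> ?V2) \<union> Pr ` Props \<union> Primed ` (?V1 \<union> ?V2)"
    using A1(5) A2(5) bdd_vars_conj[of r "sym_trans A1" "sym_trans A2"]
    by (simp add: sym_inter_def) blast
  moreover have "alphabet ?D = Pow Props" using D1(2) D2(2) by (simp add: dfa_inter_def)
  moreover have "finite (?V1 \<union> ?V2)" using A1(1) A2(1) by simp
  ultimately show ?thesis
    unfolding encodes_def vars
    using wf_dfa_inter[OF D1(1) D2(1)] robdds inj ran init final trans
    by (intro conjI exI[of _ e]) simp_all
qed

text \<open>The witness is the product DFA, whose states are pairs; \<open>symbolic_dfaI\<close>
  absorbs the change of state type.\<close>

lemma symbolic_inter: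
  assumes "linear_order r" "symbolic_dfa r Props A1" "symbolic_dfa r Props A2"
    and "state_vars A1 \<inter> state_vars A2 = {}"
  shows "symbolic_dfa r Props (sym_inter r A1 A2)"
    and "symbolic_lang r Props (sym_inter r A1 A2) =
      symbolic_lang r Props A1 \<inter> symbolic_lang r Props A2"
proof -
  obtain D1 D2 :: "('a set, nat) dfa" where D: "encodes r Props A1 D1" "encodes r Props A2 D2"
    using assms(2,3) by (auto simp: symbolic_dfa_def)
  note enc = encodes_inter[OF assms(1) D assms(4)]
  show "symbolic_dfa r Props (sym_inter r A1 A2)" by (rule symbolic_dfaI(1)[OF enc])
  show "symbolic_lang r Props (sym_inter r A1 A2) =
      symbolic_lang r Props A1 \<inter> symbolic_lang r Props A2"
    using symbolic_dfaI(2)[OF enc] D by (simp add: symbolic_lang_eq dfa_lang_inter)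
qed

lemma finite_state_vars: "symbolic_dfa r Props A \<Longrightarrow> finite (state_vars A)"
  by (auto simp: symbolic_dfa_def encodes_def)


section \<open>Termination\<close>

text \<open>A pending conjunct weighs 3, an explicit DFA 2 and a symbolic one 1, so each translation
  or conversion costs one unit and each composition removes a component. The offsets 5, 4, 3, 2, 1
  order the phases; the 7 for \<open>Test\<close> is offset 3 plus the weight 4 of the two removed
  DFAs.\<close>

fun lisa_measure :: "'p lisa_config \<Rightarrow> nat" where
  "lisa_measure (Decompose \<phi>s M) = 3 * length \<phi>s + 2 * size M + 5"
| "lisa_measure (Explicit M) = 2 * size M + 4"
| "lisa_measure (Test D1 D2 N) = 2 * size N + 7"
| "lisa_measure (Convert M K) = 2 * size M + size K + 2"
| "lisa_measure (Symbolic K) = size K + 1"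
| "lisa_measure (Return A) = 0"

lemma lisa_step_decreases:
  "lisa_step r Props t1 t2 c c' \<Longrightarrow> lisa_measure c' < lisa_measure c"
  by (induction rule: lisa_step.induct) (auto simp: two_least_def)

lemma lisa_terminates: "lisa_terminates r Props t1 t2 \<phi>s"
proof -
  have "False" if "\<forall>i. lisa_step r Props t1 t2 (c i) (c (Suc i))" for c
  proof -
    have "(c (Suc i), c i) \<in> measure lisa_measure" for i
      using lisa_step_decreases that by (metis in_measure)
    then show False using wf_measure[of lisa_measure] unfolding wf_iff_no_infinite_down_chain
      by blast
  qed
  then show ?thesis unfolding lisa_terminates_def by blast
qed


section \<open>The invariant\<close>

definition explicit_ok :: "'p set \<Rightarrow> 'p xdfa multiset \<Rightarrow> bool" where
  "explicit_ok Props M \<longleftrightarrow> (\<forall>D \<in># M. wf_dfa D \<and> alphabet D = Pow Props)"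

text \<open>The condition is phrased by removing one occurrence rather than by comparing distinct
  elements, so that it also applies to two equal copies: these must then have no state
  variables.\<close>

definition disjoint_vars :: "'p sym_dfa multiset \<Rightarrow> bool" where
  "disjoint_vars K \<longleftrightarrow>
     (\<forall>A N. K = add_mset A N \<longrightarrow> (\<forall>B \<in># N. state_vars A \<inter> state_vars B = {}))"

definition symbolic_ok :: "'p bvar rel \<Rightarrow> 'p set \<Rightarrow> 'p sym_dfa multiset \<Rightarrow> bool" where
  "symbolic_ok r Props K \<longleftrightarrow> disjoint_vars K \<and> (\<forall>A \<in># K. symbolic_dfa r Props A)"

text \<open>An intersection over an empty collection is the universal set, so the equations remain
  right when one of two collections is exhausted. The nonemptiness conditions exclude configurations
  with no component left, such as an empty \<open>Explicit\<close> or \<open>Symbolic\<close>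
  collection, from which no rule leads on.\<close>

fun lisa_inv :: "'p bvar rel \<Rightarrow> 'p set \<Rightarrow> 'p set list set \<Rightarrow> 'p lisa_config \<Rightarrow> bool" where
  "lisa_inv r Props L (Decompose \<phi>s M) \<longleftrightarrow> (\<phi>s \<noteq> [] \<or> M \<noteq> {#}) \<and> explicit_ok Props M \<and>
     (\<Inter>\<phi> \<in> set \<phi>s. ltlf_lang Props \<phi>) \<inter> (\<Inter>D \<in> set_mset M. dfa_lang D) = L"
| "lisa_inv r Props L (Explicit M) \<longleftrightarrow> M \<noteq> {#} \<and> explicit_ok Props M \<and>
     (\<Inter>D \<in> set_mset M. dfa_lang D) = L"
| "lisa_inv r Props L (Test D1 D2 N) \<longleftrightarrow> explicit_ok Props (add_mset D1 (add_mset D2 N)) \<and>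
     dfa_lang D1 \<inter> dfa_lang D2 \<inter> (\<Inter>D \<in> set_mset N. dfa_lang D) = L"
| "lisa_inv r Props L (Convert M K) \<longleftrightarrow> (M \<noteq> {#} \<or> K \<noteq> {#}) \<and>
     explicit_ok Props M \<and> symbolic_ok r Props K \<and>
     (\<Inter>D \<in> set_mset M. dfa_lang D) \<inter> (\<Inter>A \<in> set_mset K. symbolic_lang r Props A) = L"
| "lisa_inv r Props L (Symbolic K) \<longleftrightarrow> K \<noteq> {#} \<and> symbolic_ok r Props K \<and>
     (\<Inter>A \<in> set_mset K. symbolic_lang r Props A) = L"
| "lisa_inv r Props L (Return A) \<longleftrightarrow> symbolic_dfa r Props A \<and> symbolic_lang r Props A = L"

section \<open>Preservation of the invariant\<close>

lemma disjoint_vars_empty [simp]: "disjoint_vars {#}"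
  by (simp add: disjoint_vars_def)

lemma disjoint_vars_add:
  assumes "disjoint_vars K" "\<forall>B \<in># K. state_vars A \<inter> state_vars B = {}"
  shows "disjoint_vars (add_mset A K)"
  unfolding disjoint_vars_def
proof (intro allI impI ballI)
  fix B N C assume eq: "add_mset A K = add_mset B N" and C: "C \<in># N"
  \<comment> \<open>The occurrence singled out is either the new element or one of \<open>K\<close>;
    in the latter case the new element is among the others.\<close>
  from eq consider "A = B" "K = N" | K' where "K = add_mset B K'" "N = add_mset A K'"
    by (auto simp: add_eq_conv_ex)
  then show "state_vars B \<inter> state_vars C = {}"
  proof cases
    case 1
    then show ?thesis using assms(2) C by simp
  next
    case 2
    have "\<forall>E \<in># K'. state_vars B \<inter> state_vars E = {}"
      using assms(1) 2(1) by (simp add: disjoint_vars_def)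
    moreover have "state_vars A \<inter> state_vars B = {}" using assms(2) 2(1) by simp
    ultimately show ?thesis using C 2(2) by auto
  qed
qed

lemma disjoint_varsD:
  assumes "disjoint_vars (add_mset A K)"
  shows "disjoint_vars K" "B \<in># K \<Longrightarrow> state_vars A \<inter> state_vars B = {}"
proof -
  show "disjoint_vars K" unfolding disjoint_vars_def
  proof (intro allI impI ballI)
    fix B N C assume "K = add_mset B N" "C \<in># N"
    then have "add_mset A K = add_mset B (add_mset A N)" "C \<in># add_mset A N" by auto
    then show "state_vars B \<inter> state_vars C = {}" using assms unfolding disjoint_vars_def by blast
  qed
  show "B \<in># K \<Longrightarrow> state_vars A \<inter> state_vars B = {}"
    using assms by (auto simp: disjoint_vars_def)
qed

text \<open>The intersection uses exactly the variables of its two arguments, both disjoint from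
  those of every remaining element, so later intersections again have disjoint arguments.\<close>

lemma symbolic_ok_inter:
  assumes "linear_order r" "symbolic_ok r Props (add_mset A1 (add_mset A2 N))"
  shows "symbolic_ok r Props (add_mset (sym_inter r A1 A2) N)"
    and "symbolic_lang r Props (sym_inter r A1 A2) =
      symbolic_lang r Props A1 \<inter> symbolic_lang r Props A2"
proof -
  have d: "disjoint_vars (add_mset A1 (add_mset A2 N))"
    and s: "symbolic_dfa r Props A1" "symbolic_dfa r Props A2" "\<forall>A \<in># N. symbolic_dfa r Props A"
    using assms(2) by (auto simp: symbolic_ok_def)
  note d2 = disjoint_varsD(1)[OF d]
  have d12: "state_vars A1 \<inter> state_vars A2 = {}" using disjoint_varsD(2)[OF d] by simp
  have "state_vars (sym_inter r A1 A2) \<inter> state_vars B = {}" if "B \<in># N" for B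
    using disjoint_varsD(2)[OF d, of B] disjoint_varsD(2)[OF d2, of B] that
    by (auto simp: sym_inter_def)
  then have "disjoint_vars (add_mset (sym_inter r A1 A2) N)"
    using disjoint_vars_add[OF disjoint_varsD(1)[OF d2]] by blast
  then show "symbolic_ok r Props (add_mset (sym_inter r A1 A2) N)"
    using symbolic_inter(1)[OF assms(1) s(1,2) d12] s(3) by (simp add: symbolic_ok_def)
  show "symbolic_lang r Props (sym_inter r A1 A2) =
      symbolic_lang r Props A1 \<inter> symbolic_lang r Props A2"
    by (rule symbolic_inter(2)[OF assms(1) s(1,2) d12])
qed

lemma lisa_inv_step:
  assumes "linear_order r" "lisa_step r Props t1 t2 c c'" "lisa_inv r Props L c"
  shows "lisa_inv r Props L c'"
  using assms(2,3)
proof cases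
  case (translate \<phi> D \<phi>s M)
  then show ?thesis using assms(3) by (auto simp: minimal_dfa_def explicit_ok_def)
next
  case (decomposed M)
  then show ?thesis using assms(3) by simp
next
  case (single D A)
  then have "encodes r Props A D" by (simp add: symbolic_rep_def)
  from symbolic_dfaI[OF this] show ?thesis using single assms(3) by simp
next
  case (remove M D1 D2 N)
  then show ?thesis using assms(3) by (auto simp: two_least_def)
next
  case (compose D1 D2 D N)
  then show ?thesis using assms(3) by (auto simp: minimal_dfa_def explicit_ok_def dfa_lang_inter)
next
  case (switch D1 D2 N)
  then show ?thesis using assms(3) by (auto simp: symbolic_ok_def)
next
  \<comment> \<open>One factor of the language intersection passes from the explicit to the symbolic
    collection; the side condition of the rule keeps the variables disjoint.\<close>
  case (convert D A K M)
  then have enc: "encodes r Props A D" by (simp add: symbolic_rep_def)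
  have "symbolic_ok r Props (add_mset A K)"
    using convert assms(3) symbolic_dfaI(1)[OF enc] disjoint_vars_add[of K A]
    by (auto simp: symbolic_ok_def)
  then show ?thesis
    using convert assms(3) symbolic_dfaI(2)[OF enc] by (auto simp: explicit_ok_def)
next
  case (converted K)
  then show ?thesis using assms(3) by simp
next
  case (sym_compose K A1 A2 N)
  then have "K = add_mset A1 (add_mset A2 N)" by (simp add: two_least_def)
  then show ?thesis
    using sym_compose assms(3) symbolic_ok_inter[OF assms(1), of Props A1 A2 N] by auto
next
  case (finish A)
  then show ?thesis using assms(3) by (simp add: symbolic_ok_def)
qed

section \<open>Progress\<close>

lemma two_least_exists:
  assumes "M \<noteq> {#}" "\<nexists>x. M = {#x#}"
  shows "\<exists>x y N. two_least f M x y N"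
proof -
  have least: "\<exists>x N. M = add_mset x N \<and> (\<forall>z \<in># M. f x \<le> f z)" if "M \<noteq> {#}" for M
  proof -
    obtain z where "z \<in># M" using \<open>M \<noteq> {#}\<close> by auto
    from ex_has_least_nat[of "\<lambda>z. z \<in># M", OF this, of f] show ?thesis
      by (metis mset_add)
  qed
  \<comment> \<open>A least element is removed twice. The second choice is possible since
    \<open>M\<close> is not a singleton, and \<open>f x\<close> is at most \<open>f y\<close>
    because \<open>y\<close> also belongs to \<open>M\<close>.\<close>
  obtain x K where x: "M = add_mset x K" "\<forall>z \<in># M. f x \<le> f z" using least[OF assms(1)] by blast
  then obtain y N where "K = add_mset y N" "\<forall>z \<in># K. f y \<le> f z"
    using least[of K] assms(2) by blast
  with x show ?thesis unfolding two_least_def by auto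
qed

text \<open>The invariant provides what the premises of the rules ask for: well-formed DFAs over the
  right alphabet for minimization and encoding, and nonempty collections for the removals.\<close>

lemma lisa_progress:
  assumes "finite Props" "linear_order r" "lisa_inv r Props L c" "\<nexists>A. c = Return A"
  shows "\<exists>c'. lisa_step r Props t1 t2 c c'"
proof (cases c)
  case (Decompose \<phi>s M)
  show ?thesis
  proof (cases \<phi>s)
    case Nil
    then show ?thesis using Decompose lisa_step.decomposed by blast
  next
    case (Cons \<phi> \<psi>s)
    then show ?thesis
      using Decompose ltlf_dfa_exists[OF assms(1), of \<phi>] lisa_step.translate by blast
  qed
next
  case (Explicit M)
  have M: "M \<noteq> {#}" "explicit_ok Props M" using assms(3) Explicit by auto
  show ?thesis
  proof (cases "\<exists>D. M = {#D#}")
    case True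
    then obtain D where D: "M = {#D#}" by blast
    then have "wf_dfa D" "alphabet D = Pow Props" using M by (auto simp: explicit_ok_def)
    from symbolic_rep_exists[OF assms(2,1) this, of "{}"] show ?thesis
      using Explicit D lisa_step.single by blast
  next
    case False
    then show ?thesis
      using two_least_exists[OF M(1), of dfa_size] Explicit lisa_step.remove by blast
  qed
next
  case (Test D1 D2 N)
  then have D: "wf_dfa D1" "wf_dfa D2" "alphabet D1 = Pow Props" "alphabet D2 = Pow Props"
    using assms(3) by (auto simp: explicit_ok_def)
  have "alphabet (dfa_inter D1 D2) = Pow Props" using D by (simp add: dfa_inter_def)
  with minimal_dfa_exists[OF wf_dfa_inter[OF D(1,2)]]
  obtain D where "minimal_dfa (Pow Props) (dfa_lang (dfa_inter D1 D2)) D" by auto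
  \<comment> \<open>Whichever way the threshold test goes, one of the two rules applies;
    \<open>compose\<close> additionally needs the minimal DFA just obtained.\<close>
  then show ?thesis unfolding Test using lisa_step.compose lisa_step.switch by blast
next
  case (Convert M K)
  show ?thesis
  proof (cases M)
    case empty
    then show ?thesis using Convert lisa_step.converted by blast
  next
    case (add D N)
    then have D: "wf_dfa D" "alphabet D = Pow Props"
      using assms(3) Convert by (auto simp: explicit_ok_def)
    \<comment> \<open>Only finitely many variables are in use, so fresh ones remain for the next
      encoding.\<close>
    have "finite (\<Union>B \<in> set_mset K. state_vars B)"
      using assms(3) Convert finite_state_vars by (auto simp: symbolic_ok_def)
    from symbolic_rep_exists[OF assms(2,1) D this]
    obtain A where "symbolic_rep r Props D A" "\<forall>B \<in># K. state_vars A \<inter> state_vars B = {}"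
      by blast
    then show ?thesis using Convert add lisa_step.convert by blast
  qed
next
  case (Symbolic K)
  show ?thesis
  proof (cases "\<exists>A. K = {#A#}")
    case True
    then show ?thesis using Symbolic lisa_step.finish by blast
  next
    case False
    moreover have "K \<noteq> {#}" using assms(3) Symbolic by simp
    ultimately show ?thesis
      using two_least_exists[of K "\<lambda>A. bdd_nodes (sym_trans A)"] Symbolic lisa_step.sym_compose
      by blast
  qed
next
  case (Return A)
  then show ?thesis using assms(4) by blast
qed

theorem theorem1:
  fixes Props :: "'p set" and \<phi>s :: "'p ltlf list" and t1 t2 :: real and r :: "'p bvar rel"
  assumes "finite Props"
    and "\<phi>s \<noteq> []"
    and "\<forall>\<phi> \<in> set \<phi>s. ltlf_props \<phi> \<subseteq> Props"
    and "t1 > 0" and "t2 > 0"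
    and "linear_order r"
  shows "lisa_terminates r Props t1 t2 \<phi>s \<and>
    (\<forall>c. lisa_halts_in r Props t1 t2 \<phi>s c \<longrightarrow>
      (\<exists>A. c = Return A \<and> symbolic_dfa r Props A \<and>
           symbolic_lang r Props A = ltlf_lang Props (ltlf_Conj \<phi>s)))"
proof (intro conjI allI impI)
  show "lisa_terminates r Props t1 t2 \<phi>s" by (rule lisa_terminates)
next
  fix c assume c: "lisa_halts_in r Props t1 t2 \<phi>s c"
  let ?L = "ltlf_lang Props (ltlf_Conj \<phi>s)"
  have "(lisa_step r Props t1 t2)\<^sup>*\<^sup>* (lisa_init \<phi>s) c" using c by (simp add: lisa_halts_in_def)
  then have inv: "lisa_inv r Props ?L c"
  proof (induction rule: rtranclp_induct)
    case base
    \<comment> \<open>No DFA has been built yet, so the invariant reduces to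
      \<open>ltlf_lang_Conj\<close>, for which the list of conjuncts must be nonempty.\<close>
    show ?case using assms(2) by (simp add: lisa_init_def explicit_ok_def ltlf_lang_Conj)
  next
    case (step c c')
    then show ?case using lisa_inv_step[OF assms(6)] by blast
  qed
  \<comment> \<open>A configuration without successor that satisfies the invariant must be a
    \<open>Return\<close>, since \<open>lisa_progress\<close> yields a step from every other
    one.\<close>
  then obtain A where "c = Return A"
    using lisa_progress[OF assms(1,6) inv] c unfolding lisa_halts_in_def by blast
  with inv show "\<exists>A. c = Return A \<and> symbolic_dfa r Props A \<and> symbolic_lang r Props A = ?L" by simp
qed

end
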